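(* Fix a non-negative integer $k$. Given a list $\mathbf{a}=[\alpha_1,\dots,\alpha_{N+1}]$ of positive integers, the set $\mathcal{G}_{>N-k}(\mathbf{a})$ and the values $\mu(f)$ of the Möbius function of the poset $P_{>N-k}$ for all $f\in\mathcal{G}_{>N-k}(\mathbf{a})$ can be computed in time polynomial in the input size.
   Context: Let $\mathcal{I}_{>N-k}$ be the family of subsets $I\subseteq\{1,\dots,N+1\}$ with $|I|>N-k$, let $f_I=\gcd\{\alpha_i:i\in I\}$ and $\mathcal{G}_{>N-k}(\mathbf{a})=\{f_I: I\in\mathcal{I}_{>N-k}\}$. For a positive integer $f$ let $G(f)=\{\zeta\in\mathbb{C}:\zeta^f=1\}$. The poset $P_{>N-k}$ consists of the groups $G(f)$, $f\in\mathcal{G}_{>N-k}(\mathbf{a})$, ordered by reverse inclusion ($G(f)\preceq G(g)$ iff $G(g)\subseteq G(f)$, i.e. iff $g\mid f$), together with an added minimum element $\hat 0$. The Möbius function is $\mu(f)=-\mu'(\hat0,G(f))$ where $\mu'$ is the standard Möbius function of $P_{>N-k}$; equivalently $\mu$ is determined recursively by $\mu(f)=1-\sum\mu(g)$, the sum over all $g\in\mathcal{G}_{>N-k}(\mathbf{a})$ with $f\mid g$ and $g\ne f$. *)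

theory Defs
  imports Complex_Main "HOL-Library.Log_Nat" "HOL-Computational_Algebra.Polynomial"
begin

section \<open>The arithmetic data\<close>

text \<open>
  A list \<open>a\<close> of length \<open>N + 1\<close> is indexed from \<open>0\<close>, so index sets are subsets of \<open>{0..<N + 1}\<close>.
  Since \<open>N - k\<close> may be negative, the cardinality bound is taken over the integers; in that case
  the empty index set is included, and it contributes \<open>Gcd {} = 0\<close>.
\<close>

definition index_sets :: "nat \<Rightarrow> nat list \<Rightarrow> nat set set" where
  "index_sets k a =
     {I. I \<subseteq> {0..<length a} \<and> int (card I) > (int (length a) - 1) - int k}"

definition gcd_of :: "nat list \<Rightarrow> nat set \<Rightarrow> nat" where
  "gcd_of a I = Gcd ((\<lambda>i. a ! i) ` I)"

definition gcd_set :: "nat \<Rightarrow> nat list \<Rightarrow> nat set" where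
  "gcd_set k a = gcd_of a ` index_sets k a"

definition root_group :: "nat \<Rightarrow> complex set" where
  "root_group f = {\<zeta>. \<zeta> ^ f = 1}"


section \<open>Moebius functions of posets\<close>

text \<open>
  A poset is given by its order relation \<open>r\<close>, with carrier \<open>Field r\<close>. The value is the standard
  one whenever the interval from \<open>x\<close> to \<open>y\<close> is finite; the first test only makes the
  recursion well-founded.
\<close>

function poset_moebius :: "'a rel \<Rightarrow> 'a \<Rightarrow> 'a \<Rightarrow> int" where
  "poset_moebius r x y =
     (if Partial_order r \<and> finite {z. (x, z) \<in> r \<and> (z, y) \<in> r} \<and> (x, y) \<in> r
      then if x = y then 1
           else - (\<Sum>z\<in>{z. (x, z) \<in> r \<and> (z, y) \<in> r \<and> z \<noteq> y}. poset_moebius r x z)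
      else 0)"
  by pat_completeness auto
termination
proof (relation "measure (\<lambda>(r, x, y). card {z. (x, z) \<in> r \<and> (z, y) \<in> r})", goal_cases)
  case 1
  show ?case by simp
next
  case (2 r x y z)
  then have po: "Partial_order r" and fin: "finite {z. (x, z) \<in> r \<and> (z, y) \<in> r}"
    and xy: "(x, y) \<in> r" and xz: "(x, z) \<in> r" and zy: "(z, y) \<in> r" and ne: "z \<noteq> y"
    by auto
  have tr: "trans r" and an: "antisym r" and rf: "refl_on (Field r) r"
    using po by (auto simp: partial_order_on_def preorder_on_def)
  have "(y, y) \<in> r"
    using rf xy by (auto simp: refl_on_def Field_def)
  moreover have "(y, z) \<notin> r"
    using an zy ne by (auto simp: antisym_def)
  moreover have "{w. (x, w) \<in> r \<and> (w, z) \<in> r} \<subseteq> {w. (x, w) \<in> r \<and> (w, y) \<in> r}"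
    using tr zy by (auto dest: transD)
  ultimately have "{w. (x, w) \<in> r \<and> (w, z) \<in> r} \<subset> {w. (x, w) \<in> r \<and> (w, y) \<in> r}"
    using xy by blast
  then show ?case
    using fin by (simp add: psubset_card_mono)
qed

declare poset_moebius.simps [simp del]


section \<open>The poset and its Moebius function\<close>

text \<open>\<open>None\<close> is the added minimum; the groups are ordered by reverse inclusion.\<close>

definition group_poset :: "nat \<Rightarrow> nat list \<Rightarrow> complex set option rel" where
  "group_poset k a =
     {(None, None)}
     \<union> {(None, Some (root_group f)) | f. f \<in> gcd_set k a}
     \<union> {(Some (root_group f), Some (root_group g)) | f g.
          f \<in> gcd_set k a \<and> g \<in> gcd_set k a \<and> root_group g \<subseteq> root_group f}"

definition mu :: "nat \<Rightarrow> nat list \<Rightarrow> nat \<Rightarrow> int" where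
  "mu k a f = - poset_moebius (group_poset k a) None (Some (root_group f))"


section \<open>Random access machines with logarithmic cost\<close>

text \<open>
  The random access machine of Aho, Hopcroft and Ullman (The Design and Analysis of Computer
  Algorithms, Chapter 1), with the logarithmic cost criterion: registers hold integers of
  arbitrary size, register \<open>0\<close> is the accumulator, and an instruction is charged the bit lengths
  of all operands and addresses that it touches. Up to a polynomial, this time measure agrees with
  that of Turing machines.
\<close>

datatype addr = Dir nat | Ind nat

datatype operand = Imm int | At addr

datatype instr =
    LOAD operand | STORE addr
  | ADD operand | SUB operand | MULT operand | DIV operand
  | READ addr | WRITE operand
  | JUMP nat | JGTZ nat | JZERO nat | HALT

record config =
  pc :: nat
  regs :: "nat \<Rightarrow> int"
  inp :: "int list"
  outp :: "int list"

definition bitlength :: "int \<Rightarrow> nat" where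
  "bitlength x = max 1 (floorlog 2 (nat \<bar>x\<bar>))"

text \<open>Indirect addressing through a register with negative contents is an error.\<close>

fun address :: "(nat \<Rightarrow> int) \<Rightarrow> addr \<Rightarrow> nat option" where
  "address R (Dir i) = Some i"
| "address R (Ind i) = (if R i \<ge> 0 then Some (nat (R i)) else None)"

fun operand_value :: "(nat \<Rightarrow> int) \<Rightarrow> operand \<Rightarrow> int option" where
  "operand_value R (Imm x) = Some x"
| "operand_value R (At d) = map_option R (address R d)"

fun address_cost :: "(nat \<Rightarrow> int) \<Rightarrow> addr \<Rightarrow> nat" where
  "address_cost R (Dir i) = bitlength (int i)"
| "address_cost R (Ind i) = bitlength (int i) + bitlength (R i)"

fun operand_cost :: "(nat \<Rightarrow> int) \<Rightarrow> operand \<Rightarrow> nat" where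
  "operand_cost R (Imm x) = bitlength x"
| "operand_cost R (At (Dir i)) = address_cost R (Dir i) + bitlength (R i)"
| "operand_cost R (At (Ind i)) = address_cost R (Ind i) + bitlength (R (nat (R i)))"

text \<open>
  Reading past the end of the input yields \<open>0\<close>, which thereby serves as an end marker for inputs
  without zeros.
\<close>

definition next_input :: "config \<Rightarrow> int" where
  "next_input c = (case inp c of [] \<Rightarrow> 0 | x # _ \<Rightarrow> x)"

definition set_acc :: "int \<Rightarrow> config \<Rightarrow> config" where
  "set_acc x c = c\<lparr>pc := Suc (pc c), regs := (regs c)(0 := x)\<rparr>"

text \<open>\<open>None\<close> means that the instruction has no successor configuration.\<close>

fun exec_instr :: "instr \<Rightarrow> config \<Rightarrow> config option" where
  "exec_instr (LOAD p) c = map_option (\<lambda>v. set_acc v c) (operand_value (regs c) p)"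
| "exec_instr (STORE d) c =
     map_option (\<lambda>i. c\<lparr>pc := Suc (pc c), regs := (regs c)(i := regs c 0)\<rparr>) (address (regs c) d)"
| "exec_instr (ADD p) c = map_option (\<lambda>v. set_acc (regs c 0 + v) c) (operand_value (regs c) p)"
| "exec_instr (SUB p) c = map_option (\<lambda>v. set_acc (regs c 0 - v) c) (operand_value (regs c) p)"
| "exec_instr (MULT p) c = map_option (\<lambda>v. set_acc (regs c 0 * v) c) (operand_value (regs c) p)"
| "exec_instr (DIV p) c =
     (case operand_value (regs c) p of
        None \<Rightarrow> None
      | Some v \<Rightarrow> if v = 0 then None else Some (set_acc (regs c 0 div v) c))"
| "exec_instr (READ d) c =
     map_option (\<lambda>i. c\<lparr>pc := Suc (pc c), regs := (regs c)(i := next_input c), inp := tl (inp c)\<rparr>)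
       (address (regs c) d)"
| "exec_instr (WRITE p) c =
     map_option (\<lambda>v. c\<lparr>pc := Suc (pc c), outp := outp c @ [v]\<rparr>) (operand_value (regs c) p)"
| "exec_instr (JUMP b) c = Some (c\<lparr>pc := b\<rparr>)"
| "exec_instr (JGTZ b) c = Some (c\<lparr>pc := (if regs c 0 > 0 then b else Suc (pc c))\<rparr>)"
| "exec_instr (JZERO b) c = Some (c\<lparr>pc := (if regs c 0 = 0 then b else Suc (pc c))\<rparr>)"
| "exec_instr HALT c = None"

fun instr_cost :: "instr \<Rightarrow> config \<Rightarrow> nat" where
  "instr_cost (LOAD p) c = operand_cost (regs c) p"
| "instr_cost (STORE d) c = bitlength (regs c 0) + address_cost (regs c) d"
| "instr_cost (ADD p) c = bitlength (regs c 0) + operand_cost (regs c) p"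
| "instr_cost (SUB p) c = bitlength (regs c 0) + operand_cost (regs c) p"
| "instr_cost (MULT p) c = bitlength (regs c 0) + operand_cost (regs c) p"
| "instr_cost (DIV p) c = bitlength (regs c 0) + operand_cost (regs c) p"
| "instr_cost (READ d) c = bitlength (next_input c) + address_cost (regs c) d"
| "instr_cost (WRITE p) c = operand_cost (regs c) p"
| "instr_cost (JUMP b) c = 1"
| "instr_cost (JGTZ b) c = bitlength (regs c 0)"
| "instr_cost (JZERO b) c = bitlength (regs c 0)"
| "instr_cost HALT c = 1"

text \<open>
  \<open>ram_run P c ys t\<close>: started in configuration \<open>c\<close>, the program \<open>P\<close> reaches \<open>HALT\<close> with output
  tape \<open>ys\<close>, in total time \<open>t\<close>.
\<close>

inductive ram_run :: "instr list \<Rightarrow> config \<Rightarrow> int list \<Rightarrow> nat \<Rightarrow> bool" for P where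
  halt: "pc c < length P \<Longrightarrow> P ! pc c = HALT \<Longrightarrow> ram_run P c (outp c) (instr_cost HALT c)"
| step: "pc c < length P \<Longrightarrow> exec_instr (P ! pc c) c = Some c' \<Longrightarrow> ram_run P c' ys t \<Longrightarrow>
    ram_run P c ys (instr_cost (P ! pc c) c + t)"

definition start_config :: "int list \<Rightarrow> config" where
  "start_config xs = \<lparr>pc = 0, regs = (\<lambda>_. 0), inp = xs, outp = []\<rparr>"

definition input_size :: "int list \<Rightarrow> nat" where
  "input_size xs = (\<Sum>x\<leftarrow>xs. bitlength x)"

text \<open>
  On every instance \<open>x \<in> X\<close>, encoded as \<open>enc x\<close>, one fixed program produces an output that is
  correct in the sense of \<open>correct x\<close>, within a fixed polynomial in the binary size of the input.
\<close>

definition poly_time_computable ::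
    "'a set \<Rightarrow> ('a \<Rightarrow> int list) \<Rightarrow> ('a \<Rightarrow> int list \<Rightarrow> bool) \<Rightarrow> bool" where
  "poly_time_computable X enc correct \<longleftrightarrow>
     (\<exists>P (p :: nat poly). \<forall>x\<in>X. \<exists>ys t.
        ram_run P (start_config (enc x)) ys t \<and> correct x ys \<and> t \<le> poly p (input_size (enc x)))"

text \<open>
  The output lists every element \<open>f\<close> of the gcd set exactly once, in some order, each followed by
  its value \<open>mu k a f\<close>.
\<close>

definition is_moebius_table :: "nat \<Rightarrow> nat list \<Rightarrow> int list \<Rightarrow> bool" where
  "is_moebius_table k a ys \<longleftrightarrow>
     (\<exists>fs. distinct fs \<and> set fs = gcd_set k a \<and> ys = concat (map (\<lambda>f. [int f, mu k a f]) fs))"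

end

theory Submission
  imports Defs
begin

text \<open>
  Reading the list from left to right, one maintains the gcds of all subsets of the prefix that omit
  at most \<open>k\<close> of its entries, without removing duplicates: there are only
  \<open>\<Sum>j\<le>k. n choose j\<close> of them for a prefix of length \<open>n\<close>. The table is then produced by repeatedly
  extracting the largest gcd below the last one, with \<open>0\<close> first: in this order all proper multiples
  of \<open>f\<close> precede \<open>f\<close>, so the recursion for \<open>\<mu>\<close> applies, and it gives \<open>\<bar>\<mu>\<bar> \<le> 2 ^ i\<close> for the \<open>i\<close>-th
  entry (counted from \<open>0\<close>). Hence all numbers that occur have polynomially many bits.

  The algorithm is written in a small imperative language. Its compilation to the random access
  machine costs a constant number of instructions per step, each of logarithmic cost linear in a
  bound \<open>B\<close> on the bit lengths of all values.
\<close>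

section \<open>The gcd set and the Moebius recursion\<close>

text \<open>Under logarithmic cost, counting steps does not suffice: every intermediate value must
  also be short. The size bound \<open>B\<close> is therefore built into the runs of the language,
  and time bounds are proved for such runs only. Fixing \<open>k\<close> matters twice: it is the
  exponent in the bound on the number of entries, and that bound in turn limits the bit length of
  the Moebius values, which may double with each new table entry. Duplicates can stay because
  extraction by strictly decreasing values passes over equal ones; keeping them makes the count an
  exact sum of binomial coefficients and saves all searching. The gcd 0, which occurs exactly if
  there are at most \<open>k\<close> entries, needs its own route: numerically it is the least
  value, in divisibility it is a multiple of everything, and in the search for a maximum it already
  serves as the answer that nothing was found.\<close>

lemma root_group_subset_iff: "root_group g \<subseteq> root_group f \<longleftrightarrow> g dvd f"
proof
  assume sub: "root_group g \<subseteq> root_group f"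
  show "g dvd f"
  \<comment> \<open>Exponent 0 gives the whole plane, which cannot be counted; but it contains 0,
    which is no root of unity for a positive exponent.\<close>
  proof (cases "f = 0 \<or> g = 0")
    case True
    moreover have "f = 0" if "g = 0"
    proof (rule ccontr)
      assume "f \<noteq> 0"
      have "(0::complex) \<in> root_group f"
        using sub that by (auto simp: root_group_def)
      with \<open>f \<noteq> 0\<close> show False by (simp add: root_group_def zero_power)
    qed
    ultimately show ?thesis by auto
  next
    case False
    then obtain x y where xy: "g * x = f * y + gcd g f"
      using bezout_nat[of g f] by blast
    \<comment> \<open>Bezout puts all \<open>g\<close> roots for \<open>g\<close> among the
      \<open>gcd g f\<close> roots for the gcd, so counting yields
      \<open>g \<le> gcd g f\<close>.\<close>
    have "root_group g \<subseteq> root_group (gcd g f)"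
    proof
      fix z assume z: "z \<in> root_group g"
      with sub have "z ^ g = 1" "z ^ f = 1" by (auto simp: root_group_def)
      then have "1 = z ^ (g * x)" "z ^ (f * y) = 1" by (simp_all add: power_mult)
      then have "z ^ gcd g f = 1" by (simp add: xy power_add)
      then show "z \<in> root_group (gcd g f)" by (simp add: root_group_def)
    qed
    moreover have "card (root_group n) = n" "finite (root_group n)" if "n > 0" for n
      using that card_roots_unity_eq[of n] finite_roots_unity[of n] by (simp_all add: root_group_def)
    ultimately have "g \<le> gcd g f"
      using False by (metis card_mono gcd_pos_nat neq0_conv)
    then have "gcd g f = g"
      using False by (simp add: gcd_le1_nat le_antisym)
    then show ?thesis by (metis gcd_dvd2)
  qed
next
  assume "g dvd f"
  then show "root_group g \<subseteq> root_group f"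
    by (auto simp: root_group_def power_mult elim!: dvdE)
qed

lemma root_group_eq_iff [simp]: "root_group g = root_group f \<longleftrightarrow> g = f"
  using root_group_subset_iff by (metis dvd_antisym order_refl)

lemma finite_gcd_set: "finite (gcd_set k a)"
proof -
  have "index_sets k a \<subseteq> Pow {0..<length a}"
    by (auto simp: index_sets_def)
  then show ?thesis
    unfolding gcd_set_def by (meson finite_Pow_iff finite_atLeastLessThan finite_imageI finite_subset)
qed

lemma group_poset_simps [simp]:
  "(None, None) \<in> group_poset k a"
  "(Some A, None) \<notin> group_poset k a"
  "(None, Some (root_group f)) \<in> group_poset k a \<longleftrightarrow> f \<in> gcd_set k a"
  "(Some (root_group f), Some (root_group g)) \<in> group_poset k a \<longleftrightarrow>
     f \<in> gcd_set k a \<and> g \<in> gcd_set k a \<and> g dvd f"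
  by (auto simp: group_poset_def root_group_subset_iff)

lemma group_poset_cases:
  assumes "(x, y) \<in> group_poset k a"
  obtains "x = None" "y = None"
  | f where "x = None" "y = Some (root_group f)" "f \<in> gcd_set k a"
  | f g where "x = Some (root_group f)" "y = Some (root_group g)" "f \<in> gcd_set k a"
      "g \<in> gcd_set k a" "g dvd f"
  using assms by (auto simp: group_poset_def root_group_subset_iff)

lemma partial_order_group_poset: "Partial_order (group_poset k a)"
  unfolding partial_order_on_def preorder_on_def
proof (intro conjI)
  show "refl_on (Field (group_poset k a)) (group_poset k a)"
    by (auto simp: refl_on_def Field_def elim!: group_poset_cases)
  show "trans (group_poset k a)"
    by (rule transI) (force elim!: group_poset_cases dest: dvd_trans)
  show "antisym (group_poset k a)"
    by (rule antisymI) (auto elim!: group_poset_cases dest: dvd_antisym)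
  show "group_poset k a \<subseteq> Field (group_poset k a) \<times> Field (group_poset k a)"
    by (auto simp: Field_def)
qed

text \<open>The added minimum has Moebius value 1 and supplies the leading 1. The sign in
  \<open>mu\<close> cancels the one in the recursion of \<open>poset_moebius\<close>, so it
  reappears only in front of the sum over the groups.\<close>

lemma mu_rec:
  assumes f: "f \<in> gcd_set k a"
  shows "mu k a f = 1 - (\<Sum>g\<in>{g \<in> gcd_set k a. f dvd g \<and> g \<noteq> f}. mu k a g)"
proof -
  let ?r = "group_poset k a" and ?y = "Some (root_group f)"
  let ?M = "{g \<in> gcd_set k a. f dvd g \<and> g \<noteq> f}"
  have None: "poset_moebius ?r None None = 1"
  proof -
    have "{z. (None, z) \<in> ?r \<and> (z, None) \<in> ?r} = {None}"
      by (auto elim!: group_poset_cases)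
    then show ?thesis
      using partial_order_group_poset by (subst poset_moebius.simps) simp
  qed
  have eq: "{z. (None, z) \<in> ?r \<and> (z, ?y) \<in> ?r \<and> z \<noteq> ?y} =
      insert None ((\<lambda>g. Some (root_group g)) ` ?M)"
    using f by (auto elim!: group_poset_cases)
  have fin: "finite ?M"
    using finite_gcd_set by simp
  \<comment> \<open>Finiteness of the interval has to be shown because \<open>poset_moebius\<close>
    defaults to 0 when its test fails.\<close>
  have "{z. (None, z) \<in> ?r \<and> (z, ?y) \<in> ?r} \<subseteq>
      insert ?y {z. (None, z) \<in> ?r \<and> (z, ?y) \<in> ?r \<and> z \<noteq> ?y}"
    by auto
  then have "finite {z. (None, z) \<in> ?r \<and> (z, ?y) \<in> ?r}"
    unfolding eq using fin by (meson finite.insertI finite_imageI finite_subset)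
  then have "mu k a f = (\<Sum>z\<in>{z. (None, z) \<in> ?r \<and> (z, ?y) \<in> ?r \<and> z \<noteq> ?y}. poset_moebius ?r None z)"
    unfolding mu_def using f partial_order_group_poset by (subst poset_moebius.simps) auto
  also have "\<dots> = 1 + (\<Sum>g\<in>?M. poset_moebius ?r None (Some (root_group g)))"
    unfolding eq using fin None by (subst sum.insert) (auto simp: sum.reindex inj_on_def)
  also have "\<dots> = 1 - (\<Sum>g\<in>?M. mu k a g)"
    by (simp add: mu_def sum_negf)
  finally show ?thesis .
qed

section \<open>Enumeration of the gcds by the omitted indices\<close>

definition omit_step :: "nat \<Rightarrow> nat \<Rightarrow> (nat \<times> nat) list \<Rightarrow> (nat \<times> nat) list" where
  "omit_step k x ps =
     map (\<lambda>(d, g). (d, gcd g x)) ps @ map (\<lambda>(d, g). (Suc d, g)) (filter (\<lambda>(d, g). d < k) ps)"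

text \<open>
  The entries \<open>(d, g)\<close> correspond to the ways of omitting \<open>d \<le> k\<close> entries of \<open>a\<close>, where \<open>g\<close> is
  the gcd of the others.
\<close>

definition omit_list :: "nat \<Rightarrow> nat list \<Rightarrow> (nat \<times> nat) list" where
  "omit_list k a = fold (omit_step k) a [(0, 0)]"

lemma omit_list_Nil [simp]: "omit_list k [] = [(0, 0)]"
  and omit_list_snoc [simp]: "omit_list k (a @ [x]) = omit_step k x (omit_list k a)"
  by (simp_all add: omit_list_def)

lemma gcd_of_snoc_insert:
  assumes "I \<subseteq> {..<length a}"
  shows "gcd_of (a @ [x]) (insert (length a) I) = gcd (gcd_of a I) x"
proof -
  have "(!) (a @ [x]) ` I = (!) a ` I"
    using assms by (auto intro!: image_cong simp: nth_append)
  then show ?thesis by (simp add: gcd_of_def gcd.commute)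
qed

lemma gcd_of_snoc:
  assumes "I \<subseteq> {..<length a}"
  shows "gcd_of (a @ [x]) I = gcd_of a I"
  unfolding gcd_of_def using assms by (intro arg_cong[where f = Gcd] image_cong) (auto simp: nth_append)

lemma subsets_lessThan_Suc:
  "{J. J \<subseteq> {..<Suc n} \<and> card J \<le> k} =
     {J. J \<subseteq> {..<n} \<and> card J \<le> k} \<union> insert n ` {J. J \<subseteq> {..<n} \<and> card J < k}"
proof -
  have card: "card (insert n J) = Suc (card J)" if "J \<in> Pow {..<n}" for J
    using that finite_subset[of J "{..<n}"] by (subst card_insert_disjoint) auto
  have "{J. J \<subseteq> {..<Suc n} \<and> card J \<le> k} = {J \<in> Pow {..<n} \<union> insert n ` Pow {..<n}. card J \<le> k}"
    by (simp add: lessThan_Suc flip: Pow_insert)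
  also have "\<dots> = {J \<in> Pow {..<n}. card J \<le> k} \<union> insert n ` {J \<in> Pow {..<n}. card (insert n J) \<le> k}"
    by blast
  also have "{J \<in> Pow {..<n}. card (insert n J) \<le> k} = {J \<in> Pow {..<n}. card J < k}"
    by (rule Collect_cong) (use card in \<open>metis Suc_le_eq\<close>)
  finally show ?thesis by (simp only: Pow_iff)
qed

text \<open>\<open>J\<close> is the set of omitted indices. A new last index is either kept, which
  enlarges the complement and takes the gcd with \<open>x\<close>, or omitted, which leaves the
  complement alone and raises \<open>card J\<close>.\<close>

lemma set_omit_list:
  "set (omit_list k a) =
     (\<lambda>J. (card J, gcd_of a ({..<length a} - J))) ` {J. J \<subseteq> {..<length a} \<and> card J \<le> k}"
proof (induction a rule: rev_induct)
  case Nil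
  have "{J. J \<subseteq> {..<length ([] :: nat list)} \<and> card J \<le> k} = {{}}" by force
  then show ?case by (simp add: gcd_of_def)
next
  case (snoc x a)
  let ?n = "length a"
  let ?S = "{J. J \<subseteq> {..<?n} \<and> card J \<le> k}" and ?S' = "{J. J \<subseteq> {..<?n} \<and> card J < k}"
  have eq1: "gcd_of (a @ [x]) ({..<Suc ?n} - J) = gcd (gcd_of a ({..<?n} - J)) x"
    if "J \<subseteq> {..<?n}" for J
  proof -
    have "{..<Suc ?n} - J = insert ?n ({..<?n} - J)" using that by auto
    then show ?thesis by (simp only: gcd_of_snoc_insert[OF Diff_subset])
  qed
  have eq2: "gcd_of (a @ [x]) ({..<Suc ?n} - insert ?n J) = gcd_of a ({..<?n} - J)" for J
  proof -
    have "{..<Suc ?n} - insert ?n J = {..<?n} - J" by auto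
    then show ?thesis by (simp only: gcd_of_snoc[OF Diff_subset])
  qed
  have card: "card (insert ?n J) = Suc (card J)" if "J \<subseteq> {..<?n}" for J
    using that finite_subset[OF that] by (subst card_insert_disjoint) auto
  have "set (omit_list k (a @ [x])) = (\<lambda>(d, g). (d, gcd g x)) ` set (omit_list k a) \<union>
      (\<lambda>(d, g). (Suc d, g)) ` {p \<in> set (omit_list k a). fst p < k}"
    by (auto simp: omit_step_def)
  also have "\<dots> = (\<lambda>J. (card J, gcd_of (a @ [x]) ({..<Suc ?n} - J))) ` ?S \<union>
      (\<lambda>J. (card J, gcd_of (a @ [x]) ({..<Suc ?n} - J))) ` (insert ?n ` ?S')"
    unfolding snoc.IH
  proof (rule arg_cong2[where f = "(\<union>)"])
    show "(\<lambda>(d, g). (d, gcd g x)) ` (\<lambda>J. (card J, gcd_of a ({..<?n} - J))) ` ?S =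
        (\<lambda>J. (card J, gcd_of (a @ [x]) ({..<Suc ?n} - J))) ` ?S"
      unfolding image_image by (intro image_cong) (auto simp: eq1)
    have "{p \<in> (\<lambda>J. (card J, gcd_of a ({..<?n} - J))) ` ?S. fst p < k} =
        (\<lambda>J. (card J, gcd_of a ({..<?n} - J))) ` ?S'"
      by auto
    then have "(\<lambda>(d, g). (Suc d, g)) ` {p \<in> (\<lambda>J. (card J, gcd_of a ({..<?n} - J))) ` ?S. fst p < k} =
        (\<lambda>J. (Suc (card J), gcd_of a ({..<?n} - J))) ` ?S'"
      by (simp add: image_image)
    also have "\<dots> = (\<lambda>J. (card J, gcd_of (a @ [x]) ({..<Suc ?n} - J))) ` (insert ?n ` ?S')"
      unfolding image_image by (rule image_cong) (simp_all add: eq2 card)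
    finally show "(\<lambda>(d, g). (Suc d, g)) ` {p \<in> (\<lambda>J. (card J, gcd_of a ({..<?n} - J))) ` ?S. fst p < k} =
        (\<lambda>J. (card J, gcd_of (a @ [x]) ({..<Suc ?n} - J))) ` (insert ?n ` ?S')" .
  qed
  finally show ?case by (simp only: subsets_lessThan_Suc image_Un length_append_singleton)
qed

text \<open>Passing to complements turns the lower bound on \<open>card I\<close> into
  \<open>card J \<le> k\<close>, also when \<open>k\<close> exceeds the length and the bound in
  \<open>index_sets\<close> is negative.\<close>

lemma snd_set_omit_list: "snd ` set (omit_list k a) = gcd_set k a"
proof -
  let ?U = "{..<length a}"
  have "index_sets k a = (\<lambda>J. ?U - J) ` {J. J \<subseteq> ?U \<and> card J \<le> k}"
  proof (intro equalityI subsetI)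
    fix I assume I: "I \<in> index_sets k a"
    then have "I \<subseteq> ?U" "card I \<le> length a"
      using card_mono[of ?U I] by (auto simp: index_sets_def atLeast0LessThan)
    with I have "card (?U - I) \<le> k"
      by (subst card_Diff_subset) (auto simp: index_sets_def atLeast0LessThan finite_subset)
    with \<open>I \<subseteq> ?U\<close> show "I \<in> (\<lambda>J. ?U - J) ` {J. J \<subseteq> ?U \<and> card J \<le> k}"
      by (intro image_eqI[of _ _ "?U - I"]) auto
  next
    fix I assume "I \<in> (\<lambda>J. ?U - J) ` {J. J \<subseteq> ?U \<and> card J \<le> k}"
    then obtain J where J: "I = ?U - J" "J \<subseteq> ?U" "card J \<le> k" by auto
    then have "card I = length a - card J" "card J \<le> length a"
      using card_mono[of ?U J] by (simp_all add: card_Diff_subset finite_subset)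
    with J show "I \<in> index_sets k a" by (auto simp: index_sets_def)
  qed
  then show ?thesis
    by (simp add: set_omit_list gcd_set_def image_image)
qed

text \<open>Pascal's rule: the kept branch preserves the number of omissions and the omitted branch
  raises it by one. The count is exact because duplicates stay in the list.\<close>

lemma length_filter_omit_list:
  "length (filter (\<lambda>p. fst p = j) (omit_list k a)) = (if j \<le> k then length a choose j else 0)"
proof (induction a arbitrary: j rule: rev_induct)
  case Nil
  show ?case by (cases j) auto
next
  case (snoc x a)
  let ?ps = "omit_list k a"
  have "length (filter (\<lambda>p. fst p = j) (omit_list k (a @ [x]))) =
      length (filter (\<lambda>p. fst p = j) ?ps) + length (filter (\<lambda>p. Suc (fst p) = j \<and> fst p < k) ?ps)"
    by (simp add: omit_step_def filter_map o_def case_prod_unfold conj_commute)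
  also have "\<dots> = (if j \<le> k then Suc (length a) choose j else 0)"
  proof (cases j)
    case 0
    then show ?thesis using snoc[of 0] by simp
  next
    case (Suc i)
    then have "filter (\<lambda>p. Suc (fst p) = j \<and> fst p < k) ?ps =
        (if j \<le> k then filter (\<lambda>p. fst p = i) ?ps else [])"
      by (auto intro!: filter_cong simp: filter_empty_conv)
    then show ?thesis using snoc[of i] snoc[of j] Suc by auto
  qed
  finally show ?case by simp
qed

lemma length_eq_sum_filter:
  fixes k :: nat
  shows "\<forall>x\<in>set xs. f x \<le> k \<Longrightarrow> length xs = (\<Sum>j\<le>k. length (filter (\<lambda>x. f x = j) xs))"
proof (induction xs)
  case (Cons x xs)
  have "(\<Sum>j\<le>k. length (filter (\<lambda>x. f x = j) (x # xs))) =
      (\<Sum>j\<le>k. (if j = f x then 1 else 0) + length (filter (\<lambda>x. f x = j) xs))"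
    by (intro sum.cong) auto
  also have "\<dots> = (\<Sum>j\<le>k. if j = f x then 1 else 0) + length xs"
    using Cons by (simp add: sum.distrib)
  also have "(\<Sum>j\<le>k. if j = f x then 1 else 0) = (1 :: nat)"
    using Cons.prems by (subst sum.delta) auto
  finally show ?case by simp
qed simp

lemma length_omit_list_le: "length (omit_list k a) \<le> Suc k * Suc (length a) ^ k"
proof -
  have "length (omit_list k a) = (\<Sum>j\<le>k. length a choose j)"
    by (subst length_eq_sum_filter[of _ fst k]) (auto simp: set_omit_list length_filter_omit_list)
  also have "\<dots> \<le> (\<Sum>j\<le>k. Suc (length a) ^ k)"
  proof (rule sum_mono)
    fix j assume j: "j \<in> {..k}"
    have "length a choose j \<le> length a ^ j"
      by (cases "j \<le> length a") (auto simp: binomial_le_pow binomial_eq_0)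
    \<comment> \<open>The base is made positive so that the exponent can be raised to
      \<open>k\<close> even for the empty list.\<close>
    also have "\<dots> \<le> Suc (length a) ^ j" by (rule power_mono) auto
    also have "\<dots> \<le> Suc (length a) ^ k" using j by (intro power_increasing) auto
    finally show "length a choose j \<le> Suc (length a) ^ k" .
  qed
  finally show ?thesis by simp
qed

text \<open>Among positive entries only the empty index set has gcd 0. Hence a counter suffices for
  the program to decide whether 0 belongs to the table.\<close>

lemma zero_in_gcd_set_iff:
  assumes "\<forall>x\<in>set a. x > 0"
  shows "0 \<in> gcd_set k a \<longleftrightarrow> length a \<le> k"
proof
  assume "0 \<in> gcd_set k a"
  then obtain I where I: "I \<in> index_sets k a" "gcd_of a I = 0"
    by (auto simp: gcd_set_def)
  then have zero: "a ! i = 0" if "i \<in> I" for i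
    using that by (simp add: gcd_of_def Gcd_0_iff subset_iff)
  have "i \<notin> I" for i
  proof
    assume i: "i \<in> I"
    with I(1) have "a ! i \<in> set a" by (auto simp: index_sets_def)
    with assms zero[OF i] show False by auto
  qed
  then have "I = {}" by blast
  with I show "length a \<le> k" by (simp add: index_sets_def)
next
  assume "length a \<le> k"
  then have "{} \<in> index_sets k a" by (simp add: index_sets_def)
  then show "0 \<in> gcd_set k a"
    unfolding gcd_set_def by (intro image_eqI[of _ _ "{}"]) (auto simp: gcd_of_def)
qed

text \<open>The sum is used instead of the maximum because it can be accumulated without comparisons
  and stays polynomial in bit length.\<close>

lemma gcd_set_le:
  assumes pos: "\<forall>x\<in>set a. x > 0" and "g \<in> gcd_set k a"
  shows "g \<le> sum_list a"
proof -
  obtain I where I: "I \<subseteq> {0..<length a}" "g = gcd_of a I"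
    using assms(2) by (auto simp: gcd_set_def index_sets_def)
  show ?thesis
  proof (cases "I = {}")
    case False
    then obtain i where i: "i \<in> I" by blast
    then have mem: "a ! i \<in> set a" using I(1) by auto
    have "g dvd a ! i"
      unfolding I(2) gcd_of_def using i by (intro Gcd_dvd imageI)
    then have "g \<le> a ! i" using pos mem by (simp add: dvd_imp_le)
    also have "\<dots> \<le> sum_list a" using mem by (simp add: member_le_sum_list)
    finally show ?thesis .
  qed (simp add: I(2) gcd_of_def)
qed

section \<open>A small imperative language\<close>

text \<open>
  Of the variables, \<open>vX\<close> is the current input, \<open>vL\<close> and \<open>vK\<close> are the lengths of the list of gcds
  (in \<open>aD\<close>, \<open>aG\<close>) and of the table (in \<open>aF\<close>, \<open>aM\<close>), \<open>vZ\<close> is positive after reading iff \<open>0\<close> is among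
  the gcds, and \<open>vS\<close> is a strict upper bound on the gcds still to be written.
\<close>

datatype var = vX | vS | vZ | vL | vE | vI | vD | vG | vY | vT | vC | vR | vK

datatype arr = aD | aG | aF | aM

datatype atom = Vr var | Ct int

datatype bop = Plus | Minus | Times | Quot

datatype com =
    Skip
  | Op bop var atom atom
  | Get var arr var
  | Put arr var atom
  | Read var
  | Write atom
  | Seq com com (infixr ";;" 60)
  | IfGt atom atom com com
  | WhileGt atom atom com

record state =
  vars :: "var \<Rightarrow> int"
  arrs :: "arr \<Rightarrow> nat \<Rightarrow> int"
  sinp :: "int list"
  sout :: "int list"

fun aval :: "state \<Rightarrow> atom \<Rightarrow> int" where
  "aval s (Vr v) = vars s v"
| "aval s (Ct i) = i"

fun small_atom :: "nat \<Rightarrow> atom \<Rightarrow> bool" where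
  "small_atom B (Vr v) = True"
| "small_atom B (Ct i) = (\<bar>i\<bar> < 2 ^ B)"

fun bop_val :: "bop \<Rightarrow> int \<Rightarrow> int \<Rightarrow> int" where
  "bop_val Plus x y = x + y"
| "bop_val Minus x y = x - y"
| "bop_val Times x y = x * y"
| "bop_val Quot x y = x div y"

definition set_var :: "var \<Rightarrow> int \<Rightarrow> state \<Rightarrow> state" where
  "set_var v x s = s\<lparr>vars := (vars s)(v := x)\<rparr>"

definition set_arr :: "arr \<Rightarrow> nat \<Rightarrow> int \<Rightarrow> state \<Rightarrow> state" where
  "set_arr A i x s = s\<lparr>arrs := (arrs s)(A := (arrs s A)(i := x))\<rparr>"

text \<open>
  \<open>exec B c s t s'\<close> only holds for runs in which all computed values have at most \<open>B\<close> bits.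
\<close>

inductive exec :: "nat \<Rightarrow> com \<Rightarrow> state \<Rightarrow> nat \<Rightarrow> state \<Rightarrow> bool" for B where
  Skip: "exec B Skip s 0 s"
| Op: "small_atom B p \<Longrightarrow> small_atom B q \<Longrightarrow> (b = Quot \<Longrightarrow> aval s q \<noteq> 0) \<Longrightarrow>
    \<bar>bop_val b (aval s p) (aval s q)\<bar> < 2 ^ B \<Longrightarrow>
    exec B (Op b x p q) s 1 (set_var x (bop_val b (aval s p) (aval s q)) s)"
| Get: "vars s i \<ge> 0 \<Longrightarrow> exec B (Get x A i) s 1 (set_var x (arrs s A (nat (vars s i))) s)"
| Put: "vars s i \<ge> 0 \<Longrightarrow> small_atom B p \<Longrightarrow>
    exec B (Put A i p) s 1 (set_arr A (nat (vars s i)) (aval s p) s)"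
| Read_Nil: "sinp s = [] \<Longrightarrow> exec B (Read x) s 1 (set_var x 0 s)"
| Read_Cons: "sinp s = y # ys \<Longrightarrow> \<bar>y\<bar> < 2 ^ B \<Longrightarrow>
    exec B (Read x) s 1 (set_var x y (s\<lparr>sinp := ys\<rparr>))"
| Write: "small_atom B p \<Longrightarrow> exec B (Write p) s 1 (s\<lparr>sout := sout s @ [aval s p]\<rparr>)"
| Seq: "exec B c s t s' \<Longrightarrow> exec B d s' u s'' \<Longrightarrow> exec B (c ;; d) s (t + u) s''"
| If_True: "small_atom B p \<Longrightarrow> small_atom B q \<Longrightarrow> aval s p > aval s q \<Longrightarrow> exec B c s t s' \<Longrightarrow>
    exec B (IfGt p q c d) s (Suc t) s'"
| If_False: "small_atom B p \<Longrightarrow> small_atom B q \<Longrightarrow> \<not> aval s p > aval s q \<Longrightarrow> exec B d s t s' \<Longrightarrow>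
    exec B (IfGt p q c d) s (Suc t) s'"
| While_False: "small_atom B p \<Longrightarrow> small_atom B q \<Longrightarrow> \<not> aval s p > aval s q \<Longrightarrow>
    exec B (WhileGt p q c) s 1 s"
| While_True: "small_atom B p \<Longrightarrow> small_atom B q \<Longrightarrow> aval s p > aval s q \<Longrightarrow>
    exec B c s t s' \<Longrightarrow> exec B (WhileGt p q c) s' u s'' \<Longrightarrow>
    exec B (WhileGt p q c) s (Suc (t + u)) s''"

inductive_cases SkipE: "exec B Skip s t s'"
inductive_cases OpE: "exec B (Op b x p q) s t s'"
inductive_cases GetE: "exec B (Get x A i) s t s'"
inductive_cases PutE: "exec B (Put A i p) s t s'"
inductive_cases ReadE: "exec B (Read x) s t s'"
inductive_cases WriteE: "exec B (Write p) s t s'"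
inductive_cases SeqE: "exec B (c ;; d) s t s'"
inductive_cases IfE: "exec B (IfGt p q c d) s t s'"

section \<open>Compilation\<close>

text \<open>
  Register \<open>0\<close> is the accumulator and register \<open>1\<close> holds computed addresses. The arrays are
  interleaved, so that each of them can grow without bound.
\<close>

fun reg :: "var \<Rightarrow> nat" where
  "reg vX = 2" | "reg vS = 3" | "reg vZ = 4" | "reg vL = 5" | "reg vE = 6" | "reg vI = 7"
| "reg vD = 8" | "reg vG = 9" | "reg vY = 10" | "reg vT = 11" | "reg vC = 12" | "reg vR = 13"
| "reg vK = 14"

fun offset :: "arr \<Rightarrow> nat" where
  "offset aD = 16" | "offset aG = 17" | "offset aF = 18" | "offset aM = 19"

definition cell :: "arr \<Rightarrow> nat \<Rightarrow> nat" where
  "cell A i = 4 * i + offset A"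

fun operand_of :: "atom \<Rightarrow> operand" where
  "operand_of (Vr v) = At (Dir (reg v))"
| "operand_of (Ct i) = Imm i"

fun instr_of :: "bop \<Rightarrow> operand \<Rightarrow> instr" where
  "instr_of Plus = ADD" | "instr_of Minus = SUB" | "instr_of Times = MULT" | "instr_of Quot = DIV"

definition address_code :: "arr \<Rightarrow> var \<Rightarrow> instr list" where
  "address_code A i =
     [LOAD (At (Dir (reg i))), MULT (Imm 4), ADD (Imm (int (offset A))), STORE (Dir 1)]"

text \<open>Jumps have absolute targets, some of them behind code not yet emitted; block lengths do
  not depend on placement and so can be computed beforehand.\<close>

fun csize :: "com \<Rightarrow> nat" where
  "csize Skip = 0"
| "csize (Op b x p q) = 3"
| "csize (Get x A i) = 6"
| "csize (Put A i p) = 6"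
| "csize (Read x) = 1"
| "csize (Write p) = 1"
| "csize (c ;; d) = csize c + csize d"
| "csize (IfGt p q c d) = csize c + csize d + 4"
| "csize (WhileGt p q c) = csize c + 5"

text \<open>The number is the address at which the code is placed. In \<open>IfGt\<close> the else
  branch comes first, since \<open>JGTZ\<close> falls through when the test fails.\<close>

fun compile :: "nat \<Rightarrow> com \<Rightarrow> instr list" where
  "compile n Skip = []"
| "compile n (Op b x p q) =
     [LOAD (operand_of p), instr_of b (operand_of q), STORE (Dir (reg x))]"
| "compile n (Get x A i) = address_code A i @ [LOAD (At (Ind 1)), STORE (Dir (reg x))]"
| "compile n (Put A i p) = address_code A i @ [LOAD (operand_of p), STORE (Ind 1)]"
| "compile n (Read x) = [READ (Dir (reg x))]"
| "compile n (Write p) = [WRITE (operand_of p)]"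
| "compile n (c ;; d) = compile n c @ compile (n + csize c) d"
| "compile n (IfGt p q c d) =
     [LOAD (operand_of p), SUB (operand_of q), JGTZ (n + csize d + 4)]
     @ compile (n + 3) d @ [JUMP (n + csize c + csize d + 4)] @ compile (n + csize d + 4) c"
| "compile n (WhileGt p q c) =
     [LOAD (operand_of p), SUB (operand_of q), JGTZ (n + 4), JUMP (n + csize c + 5)]
     @ compile (n + 4) c @ [JUMP n]"

lemma length_compile [simp]: "length (compile n c) = csize c"
  by (induction n c rule: compile.induct) (auto simp: address_code_def)

section \<open>Simulation of the imperative language by the machine\<close>

definition code_at :: "instr list \<Rightarrow> nat \<Rightarrow> instr list \<Rightarrow> bool" where
  "code_at P n xs \<longleftrightarrow> (\<forall>j < length xs. n + j < length P \<and> P ! (n + j) = xs ! j)"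

lemma code_at_Nil [simp]: "code_at P n []"
  by (simp add: code_at_def)

lemma code_at_Cons [simp]:
  "code_at P n (x # xs) \<longleftrightarrow> n < length P \<and> P ! n = x \<and> code_at P (Suc n) xs"
  unfolding code_at_def by (auto simp: less_Suc_eq_0_disj)

lemma code_at_append [simp]:
  "code_at P n (xs @ ys) \<longleftrightarrow> code_at P n xs \<and> code_at P (n + length xs) ys"
  by (induction xs arbitrary: n) auto

text \<open>Counts instructions, each of cost at most \<open>W\<close>, so that the simulation deals
  with numbers of instructions and the cost enters by a single multiplication.\<close>

inductive steps :: "instr list \<Rightarrow> nat \<Rightarrow> config \<Rightarrow> nat \<Rightarrow> config \<Rightarrow> bool" for P W where
  refl: "steps P W c 0 c"
| step: "pc c < length P \<Longrightarrow> exec_instr (P ! pc c) c = Some c' \<Longrightarrow> instr_cost (P ! pc c) c \<le> W \<Longrightarrow>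
    steps P W c' t c'' \<Longrightarrow> steps P W c (Suc t) c''"

lemma steps_trans: "steps P W c t c' \<Longrightarrow> steps P W c' u c'' \<Longrightarrow> steps P W c (t + u) c''"
  by (induction rule: steps.induct) (auto intro: steps.step)

lemma ram_run_if_steps:
  assumes "steps P W c t c'" "pc c' < length P" "P ! pc c' = HALT"
  shows "\<exists>u \<le> W * t + 1. ram_run P c (outp c') u"
  using assms
proof (induction rule: steps.induct)
  case (refl c)
  then show ?case using ram_run.halt[of c P] by auto
next
  case (step c c' t c'')
  then obtain u where u: "u \<le> W * t + 1" "ram_run P c' (outp c'') u" by auto
  with step ram_run.step[OF step(1,2) u(2)] show ?case
    by (intro exI[of _ "instr_cost (P ! pc c) c + u"]) auto
qed

text \<open>\<open>B > 0\<close> is required because \<open>bitlength 0\<close> is 1.\<close>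

lemma bitlength_le: "\<bar>x\<bar> < 2 ^ B \<Longrightarrow> B > 0 \<Longrightarrow> bitlength x \<le> B"
proof -
  assume x: "\<bar>x\<bar> < 2 ^ B" and B: "B > 0"
  have "nat \<bar>x\<bar> < 2 ^ B"
    using x by (simp add: nat_less_iff)
  then have "floorlog 2 (nat \<bar>x\<bar>) \<le> B"
    by (simp add: floorlog_le_iff)
  with B show ?thesis by (simp add: bitlength_def)
qed

lemma less_bitlength: "\<bar>x\<bar> < 2 ^ bitlength x"
proof -
  have "floorlog 2 (nat \<bar>x\<bar>) \<le> bitlength x"
    by (simp add: bitlength_def)
  then have "nat \<bar>x\<bar> < 2 ^ bitlength x"
    by (simp add: floorlog_le_iff)
  then show ?thesis by (simp add: nat_less_iff)
qed

lemma reg_inj [simp]: "reg v = reg w \<longleftrightarrow> v = w"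
  by (cases v; cases w) auto

lemma reg_less: "reg v < 16"
  by (cases v) auto

lemma reg_greater [simp]: "reg v \<noteq> 0" "reg v \<noteq> 1" "reg v \<noteq> Suc 0"
  by (cases v; simp)+

lemma offset_bounds: "offset A \<ge> 16" "offset A < 20"
  by (cases A; simp)+

lemma cell_inj [simp]: "cell A i = cell A' i' \<longleftrightarrow> A = A' \<and> i = i'"
  unfolding cell_def by (cases A; cases A'; simp; presburger)

lemma cell_neq [simp]: "cell A i \<noteq> reg v" "reg v \<noteq> cell A i" "cell A i \<noteq> 0" "cell A i \<noteq> 1"
    "cell A i \<noteq> Suc 0"
  using offset_bounds(1)[of A] reg_less[of v] by (auto simp: cell_def)

text \<open>Registers 0 and 1 are left free as scratch space. The size bounds on all variables and
  cells are part of the invariant, so reading or copying a stored value needs no size condition in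
  \<open>exec\<close>.\<close>

definition rel :: "nat \<Rightarrow> state \<Rightarrow> config \<Rightarrow> bool" where
  "rel B s c \<longleftrightarrow>
     (\<forall>v. regs c (reg v) = vars s v \<and> \<bar>vars s v\<bar> < 2 ^ B) \<and>
     (\<forall>A i. regs c (cell A i) = arrs s A i \<and> \<bar>arrs s A i\<bar> < 2 ^ B) \<and>
     inp c = sinp s \<and> outp c = sout s"

lemma bitlength_reg: "bitlength (int (reg v)) \<le> 4"
  using reg_less[of v] by (intro bitlength_le) auto

lemma bitlength_1: "bitlength 1 \<le> 4" "bitlength 4 \<le> 4"
  by (rule bitlength_le; simp)+

lemma bitlength_offset: "bitlength (int (offset A)) \<le> 5"
  using offset_bounds(2)[of A] by (intro bitlength_le) auto

lemma operand_of_value: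
  "rel B s c \<Longrightarrow> operand_value (regs c) (operand_of p) = Some (aval s p)"
  by (cases p) (auto simp: rel_def)

lemma operand_of_value_upd:
  "rel B s c \<Longrightarrow> operand_value ((regs c)(0 := x)) (operand_of p) = Some (aval s p)"
  "rel B s c \<Longrightarrow> operand_value ((regs c)(0 := x, Suc 0 := y)) (operand_of p) = Some (aval s p)"
  by (cases p; auto simp: rel_def)+

lemma aval_small: "rel B s c \<Longrightarrow> small_atom B p \<Longrightarrow> \<bar>aval s p\<bar> < 2 ^ B"
  by (cases p) (auto simp: rel_def)

lemma operand_of_cost:
  assumes "rel B s c" "small_atom B p" "B > 0"
  shows "operand_cost (regs c) (operand_of p) \<le> B + 4"
    "operand_cost ((regs c)(0 := x)) (operand_of p) \<le> B + 4"
    "operand_cost ((regs c)(0 := x, Suc 0 := y)) (operand_of p) \<le> B + 4"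
proof -
  have "bitlength (aval s p) \<le> B"
    using aval_small[OF assms(1,2)] assms(3) bitlength_le by blast
  then show "operand_cost (regs c) (operand_of p) \<le> B + 4"
    and "operand_cost ((regs c)(0 := x)) (operand_of p) \<le> B + 4"
    and "operand_cost ((regs c)(0 := x, Suc 0 := y)) (operand_of p) \<le> B + 4"
    using assms(1) bitlength_reg add_mono[OF bitlength_reg]
    by (induction p) (auto simp: rel_def add.commute[of B])
qed

lemma small_diff: "\<bar>x\<bar> < 2 ^ B \<Longrightarrow> \<bar>y\<bar> < 2 ^ B \<Longrightarrow> bitlength (x - y :: int) \<le> B + 5"
  by (rule bitlength_le) (auto simp: power_add)

text \<open>A form of the step rule for literal counts: each application consumes one unit of a
  numeral, which makes straight-line code executable symbolically.\<close>

lemma steps_dec: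
  assumes "0 < t" "pc c < length P" "exec_instr (P ! pc c) c = Some c'"
    "instr_cost (P ! pc c) c \<le> W" "steps P W c' (t - 1) c''"
  shows "steps P W c t c''"
  using steps.step[OF assms(2-5)] assms(1) by simp

lemma regs_pc_update: "c\<lparr>regs := r, pc := n\<rparr> = c\<lparr>pc := n, regs := r\<rparr>" for c :: config
  by (cases c) simp

lemma steps_one:
  "pc c < length P \<Longrightarrow> P ! pc c = i \<Longrightarrow> exec_instr i c = Some c' \<Longrightarrow> instr_cost i c \<le> W \<Longrightarrow>
    steps P W c 1 c'"
  using steps.step[of c P c' W 0 c'] by (simp add: steps.refl)

text \<open>The cost bound \<open>4 * B + 20\<close> is generous: an instruction touches at most two
  numbers of \<open>B + 5\<close> bits and one fixed address or constant of at most 5 bits.\<close>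

lemma steps_address:
  assumes c: "code_at P (pc c) (address_code A i)" and r: "rel B s c" and B: "B > 0"
    and i: "vars s i \<ge> 0"
  shows "steps P (4 * B + 20) c 4
    (c\<lparr>pc := pc c + 4, regs := (regs c)(0 := int (cell A (nat (vars s i))),
       Suc 0 := int (cell A (nat (vars s i))))\<rparr>)"
    and "bitlength (int (cell A (nat (vars s i)))) \<le> B + 5"
proof -
  define v where "v = vars s i"
  have v: "regs c (reg i) = v" "\<bar>v\<bar> < 2 ^ B" "v \<ge> 0"
    using r i unfolding rel_def v_def by (blast, blast, simp)
  have b1: "bitlength v \<le> B + 5" using bitlength_le[OF v(2) B] by simp
  have b2: "bitlength (v * 4) \<le> B + 5" using v by (intro bitlength_le) (auto simp: power_add)
  have p: "(1::int) \<le> 2 ^ B" by simp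
  \<comment> \<open>Four times a \<open>B\<close>-bit index plus an offset below 20 stays below
    \<open>24 * 2 ^ B\<close>; rounding up to 32 gives the 5 extra bits.\<close>
  have "\<bar>v * 4 + int (offset A)\<bar> < 32 * 2 ^ B"
    using v(2,3) offset_bounds(2)[of A] p by linarith
  then have b3: "bitlength (v * 4 + int (offset A)) \<le> B + 5"
    by (intro bitlength_le) (auto simp: power_add)
  have e: "int (cell A (nat v)) = v * 4 + int (offset A)"
    using v(3) by (simp add: cell_def)
  show "bitlength (int (cell A (nat (vars s i)))) \<le> B + 5"
    using b3 e by (simp add: v_def)
  show "steps P (4 * B + 20) c 4
    (c\<lparr>pc := pc c + 4, regs := (regs c)(0 := int (cell A (nat (vars s i))),
       Suc 0 := int (cell A (nat (vars s i))))\<rparr>)"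
    unfolding v_def[symmetric] e
    apply (rule steps_dec, simp)
       apply (use c in \<open>simp add: address_code_def\<close>)
      apply (use c in \<open>simp add: address_code_def\<close>)
     apply (use c bitlength_reg[of i] b1 in \<open>simp add: address_code_def v\<close>)
    apply (rule steps_dec, simp)
       apply (use c in \<open>simp add: address_code_def set_acc_def\<close>)
      apply (use c in \<open>simp add: address_code_def set_acc_def\<close>)
     apply (use c bitlength_1 b1 in \<open>simp add: address_code_def v set_acc_def\<close>)
    apply (rule steps_dec, simp)
       apply (use c in \<open>simp add: address_code_def set_acc_def\<close>)
      apply (use c in \<open>simp add: address_code_def set_acc_def\<close>)
     apply (use c bitlength_offset[of A] b2 in \<open>simp add: address_code_def v set_acc_def\<close>)
    apply (rule steps_dec, simp)
       apply (use c in \<open>simp add: address_code_def set_acc_def\<close>)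
      apply (use c in \<open>simp add: address_code_def set_acc_def\<close>)
     apply (use c bitlength_1 b3 in \<open>simp add: address_code_def v set_acc_def\<close>)
    using v apply (simp add: set_acc_def steps.refl eval_nat_numeral)
    done
qed

text \<open>The machine only tests signs, so a comparison becomes the sign of a difference. This
  difference may exceed \<open>B\<close> bits, which \<open>small_diff\<close> accounts for.\<close>

lemma steps_test:
  assumes "rel B s c" "B > 0" "small_atom B p" "small_atom B q"
    and "code_at P (pc c) [LOAD (operand_of p), SUB (operand_of q), JGTZ n]"
  shows "steps P (4 * B + 20) c 3
    (c\<lparr>pc := (if aval s p > aval s q then n else pc c + 3),
       regs := (regs c)(0 := aval s p - aval s q)\<rparr>)"
proof -
  note o = operand_of_value[OF assms(1)] operand_of_value_upd[OF assms(1)]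
  note oc = operand_of_cost[OF assms(1) _ assms(2)]
  have sm: "\<bar>aval s p\<bar> < 2 ^ B" "\<bar>aval s q\<bar> < 2 ^ B"
    using aval_small[OF assms(1)] assms by auto
  have ap: "bitlength (aval s p) \<le> B"
    using sm assms(2) bitlength_le by blast
  show ?thesis
    apply (rule steps_dec, simp)
       apply (use assms in simp)
      apply (use assms o in simp)
     apply (use assms oc(1)[OF assms(3)] in simp)
    apply (rule steps_dec, simp)
       apply (use assms in \<open>simp add: set_acc_def\<close>)
      apply (use assms o in \<open>simp add: set_acc_def\<close>)
     apply (use assms ap oc(2)[OF assms(4), of "aval s p"] in \<open>simp add: set_acc_def\<close>)
    apply (rule steps_dec, simp)
       apply (use assms in \<open>simp add: set_acc_def\<close>)
      apply (use assms in \<open>simp add: set_acc_def\<close>)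
     apply (use assms small_diff[OF sm] in \<open>simp add: set_acc_def\<close>)
    apply (simp add: set_acc_def steps.refl regs_pc_update eval_nat_numeral)
    done
qed

lemma rel_set_var:
  assumes "rel B s c" "\<bar>x\<bar> < 2 ^ B" "\<And>v. regs c' (reg v) = ((regs c)(reg w := x)) (reg v)"
    "\<And>A i. regs c' (cell A i) = regs c (cell A i)" "inp c' = inp c" "outp c' = outp c"
  shows "rel B (set_var w x s) c'"
  using assms by (auto simp: rel_def set_var_def)

lemma exec_instr_of:
  assumes "operand_value (regs c) p = Some v" "b = Quot \<Longrightarrow> v \<noteq> 0"
  shows "exec_instr (instr_of b p) c = Some (set_acc (bop_val b (regs c 0) v) c)"
  using assms by (cases b) auto

lemma instr_cost_of: "instr_cost (instr_of b p) c = bitlength (regs c 0) + operand_cost (regs c) p"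
  by (cases b) auto

text \<open>Induction on the run, not the program, since a loop runs its code repeatedly. The factor
  6 comes from array accesses, which take six instructions for one time unit; the test and jumps of
  a conditional or of a loop round take at most four.\<close>

lemma compile_correct:
  assumes "exec B p s t s'" and "B > 0" and "rel B s c" and "code_at P (pc c) (compile (pc c) p)"
  shows "\<exists>n c'. steps P (4 * B + 20) c n c' \<and> rel B s' c' \<and> pc c' = pc c + csize p \<and> n \<le> 6 * t"
  using assms
proof (induction arbitrary: c rule: exec.induct)
  case (Skip s)
  then show ?case by (auto intro!: exI[of _ c] steps.refl)
next
  case (Op p q b s x)
  define v where "v = bop_val b (aval s p) (aval s q)"
  note o = operand_of_value[OF \<open>rel B s c\<close>] operand_of_value_upd[OF \<open>rel B s c\<close>]
  note oc = operand_of_cost[OF \<open>rel B s c\<close> _ \<open>B > 0\<close>]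
  have ap: "bitlength (aval s p) \<le> B"
    using aval_small[OF \<open>rel B s c\<close> \<open>small_atom B p\<close>] \<open>B > 0\<close> by (rule bitlength_le)
  have bv: "bitlength v \<le> B" using Op(4,5) unfolding v_def by (rule bitlength_le)
  define c' where "c' = c\<lparr>pc := pc c + 3, regs := (regs c)(0 := v, reg x := v)\<rparr>"
  have "steps P (4 * B + 20) c 3 c'"
    apply (rule steps_dec, simp)
       apply (use Op.prems in simp)
      apply (use Op.prems o in simp)
     apply (use Op.prems oc(1)[OF \<open>small_atom B p\<close>] in simp)
    apply (rule steps_dec, simp)
       apply (use Op.prems in \<open>simp add: set_acc_def\<close>)
      apply (use Op.prems in \<open>simp add: set_acc_def\<close>)
      apply (rule exec_instr_of[where v = "aval s q"])
       apply (use o in \<open>simp add: set_acc_def\<close>)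
      apply (use Op.hyps in simp)
     apply (use Op.prems ap oc(2)[OF \<open>small_atom B q\<close>, of "aval s p"] in \<open>simp add: set_acc_def instr_cost_of\<close>)
    apply (rule steps_dec, simp)
       apply (use Op.prems in \<open>simp add: set_acc_def\<close>)
      apply (use Op.prems in \<open>simp add: set_acc_def\<close>)
     apply (use Op.prems bv bitlength_reg[of x] v_def in \<open>simp add: set_acc_def\<close>)
    apply (simp add: set_acc_def c'_def v_def steps.refl eval_nat_numeral)
    done
  moreover have "rel B (set_var x v s) c'"
    using Op(4,6) by (intro rel_set_var[of B s c]) (auto simp: c'_def v_def)
  ultimately show ?case
    unfolding v_def[symmetric] by (intro exI[of _ 3] exI[of _ c']) (auto simp: c'_def)
next
  case (Get s i x A)
  define v where "v = arrs s A (nat (vars s i))"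
  define m where "m = int (cell A (nat (vars s i)))"
  define c1 where "c1 = c\<lparr>pc := pc c + 4, regs := (regs c)(0 := m, Suc 0 := m)\<rparr>"
  define c' where "c' = c\<lparr>pc := pc c + 6, regs := (regs c)(Suc 0 := m, 0 := v, reg x := v)\<rparr>"
  have c: "code_at P (pc c) (address_code A i)"
    and c2: "code_at P (pc c1) [LOAD (At (Ind 1)), STORE (Dir (reg x))]"
    using Get.prems by (auto simp: c1_def address_code_def eval_nat_numeral)
  have s1: "steps P (4 * B + 20) c 4 c1" and bm: "bitlength m \<le> B + 5"
    using steps_address[OF c \<open>rel B s c\<close> \<open>B > 0\<close> Get(1)] by (simp_all add: c1_def m_def)
  have v: "regs c (nat m) = v" "\<bar>v\<bar> < 2 ^ B" "nat m \<noteq> 0" "nat m \<noteq> Suc 0"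
    using Get.prems unfolding m_def v_def rel_def by simp_all
  have bv: "bitlength v \<le> B"
    using v(2) Get.prems by (intro bitlength_le)
  have "m \<ge> 0" by (simp add: m_def)
  have "steps P (4 * B + 20) c1 2 c'"
    apply (rule steps_dec, simp)
       apply (use c2 in simp)
      apply (use c2 \<open>m \<ge> 0\<close> in \<open>simp add: c1_def\<close>)
     apply (use c2 bm bv bitlength_1 v in \<open>simp add: c1_def\<close>)
    apply (rule steps_dec, simp)
       apply (use c2 in \<open>simp add: c1_def set_acc_def\<close>)
      apply (use c2 in \<open>simp add: c1_def set_acc_def\<close>)
     apply (use c2 bv bitlength_reg[of x] v in \<open>simp add: c1_def set_acc_def\<close>)
    using v apply (simp add: set_acc_def c1_def c'_def steps.refl eval_nat_numeral)
    done
  with s1 have "steps P (4 * B + 20) c (4 + 2) c'" by (rule steps_trans)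
  moreover have "rel B (set_var x v s) c'"
    using v Get.prems by (intro rel_set_var[of B s c]) (auto simp: c'_def)
  ultimately show ?case
    unfolding v_def[symmetric] by (intro exI[of _ 6] exI[of _ c']) (auto simp: c'_def)
next
  case (Put s i p A)
  define v where "v = aval s p"
  define m where "m = int (cell A (nat (vars s i)))"
  define c1 where "c1 = c\<lparr>pc := pc c + 4, regs := (regs c)(0 := m, Suc 0 := m)\<rparr>"
  define c' where
    "c' = c\<lparr>pc := pc c + 6, regs := (regs c)(Suc 0 := m, 0 := v, cell A (nat (vars s i)) := v)\<rparr>"
  have c: "code_at P (pc c) (address_code A i)"
    and c2: "code_at P (pc c1) [LOAD (operand_of p), STORE (Ind 1)]"
    using Put.prems by (auto simp: c1_def address_code_def eval_nat_numeral)
  have s1: "steps P (4 * B + 20) c 4 c1" and bm: "bitlength m \<le> B + 5"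
    using steps_address[OF c \<open>rel B s c\<close> \<open>B > 0\<close> Put(1)] by (simp_all add: c1_def m_def)
  have v: "\<bar>v\<bar> < 2 ^ B"
    using aval_small Put unfolding v_def by blast
  have bv: "bitlength v \<le> B"
    using v Put.prems by (intro bitlength_le)
  have "m \<ge> 0" by (simp add: m_def)
  note oc = operand_of_cost(3)[OF \<open>rel B s c\<close> \<open>small_atom B p\<close> \<open>B > 0\<close>, of m m]
  have "steps P (4 * B + 20) c1 2 c'"
    apply (rule steps_dec, simp)
       apply (use c2 in simp)
      apply (use c2 operand_of_value_upd[OF \<open>rel B s c\<close>] in \<open>simp add: c1_def\<close>)
     apply (use c2 oc in \<open>simp add: c1_def\<close>)
    apply (rule steps_dec, simp)
       apply (use c2 in \<open>simp add: c1_def set_acc_def\<close>)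
      apply (use c2 \<open>m \<ge> 0\<close> in \<open>simp add: c1_def set_acc_def\<close>)
     apply (use c2 bv bm bitlength_1 in \<open>simp add: c1_def set_acc_def v_def\<close>)
    apply (simp add: set_acc_def c1_def c'_def v_def m_def steps.refl eval_nat_numeral)
    done
  with s1 have "steps P (4 * B + 20) c (4 + 2) c'" by (rule steps_trans)
  moreover have "rel B (set_arr A (nat (vars s i)) v s) c'"
    using v Put.prems by (auto simp: c'_def set_arr_def rel_def)
  ultimately show ?case
    unfolding v_def[symmetric] by (intro exI[of _ 6] exI[of _ c']) (auto simp: c'_def)
next
  case (Read_Nil s x)
  let ?c' = "c\<lparr>pc := Suc (pc c), regs := (regs c)(reg x := 0), inp := []\<rparr>"
  have i: "inp c = []" using Read_Nil by (simp add: rel_def)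
  have "steps P (4 * B + 20) c 1 ?c'"
    apply (rule steps_one)
       apply (use Read_Nil.prems in simp)
      apply (use Read_Nil.prems in simp)
     apply (use i in \<open>simp add: next_input_def\<close>)
    apply (use i bitlength_reg[of x] in \<open>simp add: next_input_def bitlength_le[of 0 1]\<close>)
    using bitlength_le[of 0 1] by simp
  moreover have "rel B (set_var x 0 s) ?c'"
    using Read_Nil i by (intro rel_set_var[of B s c]) auto
  ultimately show ?case by (intro exI[of _ 1] exI[of _ ?c']) auto
next
  case (Read_Cons s y ys x)
  let ?c' = "c\<lparr>pc := Suc (pc c), regs := (regs c)(reg x := y), inp := ys\<rparr>"
  have i: "inp c = y # ys" using Read_Cons by (simp add: rel_def)
  have "steps P (4 * B + 20) c 1 ?c'"
    apply (rule steps_one)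
       apply (use Read_Cons.prems in simp)
      apply (use Read_Cons.prems in simp)
     apply (use i in \<open>simp add: next_input_def\<close>)
    using i bitlength_reg[of x] bitlength_le[of y B] Read_Cons by (simp add: next_input_def)
  moreover have "rel B (set_var x y (s\<lparr>sinp := ys\<rparr>)) ?c'"
    using Read_Cons i by (intro rel_set_var[of B _ "c\<lparr>inp := ys\<rparr>"]) (auto simp: rel_def)
  ultimately show ?case by (intro exI[of _ 1] exI[of _ ?c']) auto
next
  case (Write p s)
  let ?c' = "c\<lparr>pc := Suc (pc c), outp := outp c @ [aval s p]\<rparr>"
  have "steps P (4 * B + 20) c 1 ?c'"
    apply (rule steps_one)
       apply (use Write.prems in simp)
      apply (use Write.prems in simp)
     apply (use Write.prems operand_of_value[of B s c p] in simp)
    using operand_of_cost(1)[OF \<open>rel B s c\<close> \<open>small_atom B p\<close> \<open>B > 0\<close>] by simp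
  moreover have "rel B (s\<lparr>sout := sout s @ [aval s p]\<rparr>) ?c'"
    using Write by (auto simp: rel_def)
  ultimately show ?case by (intro exI[of _ 1] exI[of _ ?c']) auto
next
  case (Seq p s t s' q u s'')
  from Seq obtain n c' where 1: "steps P (4 * B + 20) c n c'" "rel B s' c'" "pc c' = pc c + csize p"
    "n \<le> 6 * t"
    by fastforce
  with Seq.prems have "code_at P (pc c') (compile (pc c') q)" by simp
  with Seq 1 obtain m c'' where 2: "steps P (4 * B + 20) c' m c''" "rel B s'' c''"
    "pc c'' = pc c' + csize q" "m \<le> 6 * u"
    by blast
  show ?case
    using steps_trans[OF 1(1) 2(1)] 1 2 by (intro exI[of _ "n + m"] exI[of _ c'']) auto
next
  case (If_True p q s x t s' y)
  let ?c1 = "c\<lparr>pc := pc c + csize y + 4, regs := (regs c)(0 := aval s p - aval s q)\<rparr>"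
  note t = steps_test[OF \<open>rel B s c\<close> \<open>B > 0\<close> If_True(1,2), of P "pc c + csize y + 4"]
  have s1: "steps P (4 * B + 20) c 3 ?c1"
    using t If_True.hyps If_True.prems by simp
  have "rel B s ?c1" "code_at P (pc ?c1) (compile (pc ?c1) x)"
    using If_True.prems by (auto simp: rel_def eval_nat_numeral)
  with If_True obtain n c' where 2: "steps P (4 * B + 20) ?c1 n c'" "rel B s' c'"
    "pc c' = pc ?c1 + csize x" "n \<le> 6 * t"
    by blast
  show ?case
    using steps_trans[OF s1 2(1)] 2 by (intro exI[of _ "3 + n"] exI[of _ c']) auto
next
  case (If_False p q s y t s' x)
  let ?c1 = "c\<lparr>pc := pc c + 3, regs := (regs c)(0 := aval s p - aval s q)\<rparr>"
  note t = steps_test[OF \<open>rel B s c\<close> \<open>B > 0\<close> If_False(1,2), of P "pc c + csize y + 4"]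
  have s1: "steps P (4 * B + 20) c 3 ?c1"
    using t If_False.hyps If_False.prems by simp
  have "rel B s ?c1" "code_at P (pc ?c1) (compile (pc ?c1) y)"
    using If_False.prems by (auto simp: rel_def eval_nat_numeral)
  with If_False obtain n c' where 2: "steps P (4 * B + 20) ?c1 n c'" "rel B s' c'"
    "pc c' = pc ?c1 + csize y" "n \<le> 6 * t"
    by blast
  let ?c'' = "c'\<lparr>pc := pc c + csize x + csize y + 4\<rparr>"
  have "steps P (4 * B + 20) c' 1 ?c''"
    using If_False.prems 2(3) by (intro steps_one) (auto simp: eval_nat_numeral)
  from steps_trans[OF s1 steps_trans[OF 2(1) this]] 2 show ?case
    by (intro exI[of _ "3 + (n + 1)"] exI[of _ ?c'']) (auto simp: rel_def)
next
  case (While_False p q s x)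
  let ?c1 = "c\<lparr>pc := pc c + 3, regs := (regs c)(0 := aval s p - aval s q)\<rparr>"
  note t = steps_test[OF \<open>rel B s c\<close> \<open>B > 0\<close> While_False(1,2), of P "pc c + 4"]
  have s1: "steps P (4 * B + 20) c 3 ?c1"
    using t While_False.hyps While_False.prems by simp
  let ?c'' = "?c1\<lparr>pc := pc c + csize x + 5\<rparr>"
  have "steps P (4 * B + 20) ?c1 1 ?c''"
    using While_False.prems by (intro steps_one) (auto simp: eval_nat_numeral)
  from steps_trans[OF s1 this] While_False show ?case
    by (intro exI[of _ "3 + 1"] exI[of _ ?c'']) (auto simp: rel_def)
next
  case (While_True p q s x t s' u s'')
  let ?c1 = "c\<lparr>pc := pc c + 4, regs := (regs c)(0 := aval s p - aval s q)\<rparr>"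
  note t = steps_test[OF \<open>rel B s c\<close> \<open>B > 0\<close> While_True(1,2), of P "pc c + 4"]
  have s1: "steps P (4 * B + 20) c 3 ?c1"
    using t While_True.hyps While_True.prems by simp
  have "rel B s ?c1" "code_at P (pc ?c1) (compile (pc ?c1) x)"
    using While_True.prems by (auto simp: rel_def eval_nat_numeral)
  with While_True obtain n c' where 2: "steps P (4 * B + 20) ?c1 n c'" "rel B s' c'"
    "pc c' = pc ?c1 + csize x" "n \<le> 6 * t"
    by blast
  \<comment> \<open>The backward jump restores the head of the loop, where the same code serves the
    remaining rounds.\<close>
  let ?c2 = "c'\<lparr>pc := pc c\<rparr>"
  have s3: "steps P (4 * B + 20) c' 1 ?c2"
    using While_True.prems 2(3) by (intro steps_one) (auto simp: eval_nat_numeral)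
  have "rel B s' ?c2" "code_at P (pc ?c2) (compile (pc ?c2) (WhileGt p q x))"
    using 2 While_True.prems by (auto simp: rel_def)
  with While_True.IH(2)[of ?c2] \<open>B > 0\<close> obtain m c'' where 4: "steps P (4 * B + 20) ?c2 m c''"
    "rel B s'' c''" "pc c'' = pc c + csize (WhileGt p q x)" "m \<le> 6 * u"
    by auto
  from steps_trans[OF s1 steps_trans[OF 2(1) steps_trans[OF s3 4(1)]]] 2 4 show ?case
    by (intro exI[of _ "3 + (n + (1 + m))"] exI[of _ c'']) auto
qed

lemma exec_imp_ram_run:
  assumes "exec B p \<lparr>vars = \<lambda>_. 0, arrs = \<lambda>_ _. 0, sinp = xs, sout = []\<rparr> t s'" and "B > 0"
  shows "\<exists>u \<le> (4 * B + 20) * (6 * t) + 1. ram_run (compile 0 p @ [HALT]) (start_config xs) (sout s') u"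
proof -
  let ?P = "compile 0 p @ [HALT]"
  have "rel B \<lparr>vars = \<lambda>_. 0, arrs = \<lambda>_ _. 0, sinp = xs, sout = []\<rparr> (start_config xs)"
    by (simp add: rel_def start_config_def)
  moreover have "code_at ?P 0 ?P" by (simp add: code_at_def)
  then have "code_at ?P (pc (start_config xs)) (compile (pc (start_config xs)) p)"
    unfolding start_config_def by simp
  ultimately obtain n c' where *: "steps ?P (4 * B + 20) (start_config xs) n c'" "rel B s' c'"
      "pc c' = pc (start_config xs) + csize p" "n \<le> 6 * t"
    using compile_correct[OF assms] by blast
  then have "pc c' < length ?P" "?P ! pc c' = HALT" "outp c' = sout s'"
    by (simp_all add: start_config_def rel_def nth_append)
  with ram_run_if_steps[OF *(1)] obtain u where u: "u \<le> (4 * B + 20) * n + 1"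
      "ram_run ?P (start_config xs) (sout s') u"
    by metis
  moreover have "(4 * B + 20) * n \<le> (4 * B + 20) * (6 * t)"
    using *(4) by (rule mult_left_mono) simp
  ultimately show ?thesis by (meson add_le_mono1 order_trans)
qed

section \<open>Total correctness with running times\<close>

text \<open>Asserting that a bounded run exists gives termination, absence of overflow beyond
  \<open>B\<close> bits, and the time \<open>t\<close> at once. The rules below are equivalences, so
  the simplifier can execute straight-line code.\<close>

definition wp :: "nat \<Rightarrow> com \<Rightarrow> (nat \<Rightarrow> state \<Rightarrow> bool) \<Rightarrow> state \<Rightarrow> bool" where
  "wp B c Q s \<longleftrightarrow> (\<exists>t s'. exec B c s t s' \<and> Q t s')"

lemma vars_set_var [simp]: "vars (set_var x v s) y = (if y = x then v else vars s y)"
  and arrs_set_var [simp]: "arrs (set_var x v s) = arrs s"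
  and sinp_set_var [simp]: "sinp (set_var x v s) = sinp s"
  and sout_set_var [simp]: "sout (set_var x v s) = sout s"
  by (simp_all add: set_var_def)

lemma vars_set_arr [simp]: "vars (set_arr A i v s) = vars s"
  and arrs_set_arr [simp]: "arrs (set_arr A i v s) A' j = (if A' = A \<and> j = i then v else arrs s A' j)"
  and sinp_set_arr [simp]: "sinp (set_arr A i v s) = sinp s"
  and sout_set_arr [simp]: "sout (set_arr A i v s) = sout s"
  by (simp_all add: set_arr_def)

lemma wp_Skip [simp]: "wp B Skip Q s \<longleftrightarrow> Q 0 s"
  by (auto simp: wp_def elim: SkipE intro: exec.Skip)

lemma wp_Op [simp]:
  "wp B (Op b x p q) Q s \<longleftrightarrow> small_atom B p \<and> small_atom B q \<and> (b = Quot \<longrightarrow> aval s q \<noteq> 0) \<and>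
     \<bar>bop_val b (aval s p) (aval s q)\<bar> < 2 ^ B \<and> Q 1 (set_var x (bop_val b (aval s p) (aval s q)) s)"
  by (auto simp: wp_def simp flip: One_nat_def elim!: OpE intro!: exI conjI exec.Op)

lemma wp_Get [simp]:
  "wp B (Get x A i) Q s \<longleftrightarrow> vars s i \<ge> 0 \<and> Q 1 (set_var x (arrs s A (nat (vars s i))) s)"
  by (auto simp: wp_def simp flip: One_nat_def elim!: GetE intro!: exI conjI exec.Get)

lemma wp_Put [simp]:
  "wp B (Put A i p) Q s \<longleftrightarrow> vars s i \<ge> 0 \<and> small_atom B p \<and>
     Q 1 (set_arr A (nat (vars s i)) (aval s p) s)"
  by (auto simp: wp_def simp flip: One_nat_def elim!: PutE intro!: exI conjI exec.Put)

lemma wp_Read [simp]: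
  "wp B (Read x) Q s \<longleftrightarrow>
     (case sinp s of [] \<Rightarrow> Q 1 (set_var x 0 s)
      | y # ys \<Rightarrow> \<bar>y\<bar> < 2 ^ B \<and> Q 1 (set_var x y (s\<lparr>sinp := ys\<rparr>)))"
  by (cases "sinp s") (auto simp: wp_def simp flip: One_nat_def elim!: ReadE
      intro!: exI conjI exec.Read_Nil exec.Read_Cons)

lemma wp_Write [simp]:
  "wp B (Write p) Q s \<longleftrightarrow> small_atom B p \<and> Q 1 (s\<lparr>sout := sout s @ [aval s p]\<rparr>)"
  by (auto simp: wp_def simp flip: One_nat_def elim!: WriteE intro!: exI conjI exec.Write)

lemma wp_Seq [simp]: "wp B (c ;; d) Q s \<longleftrightarrow> wp B c (\<lambda>t. wp B d (\<lambda>u. Q (t + u))) s"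
  by (auto simp: wp_def elim!: SeqE intro: exec.Seq; blast intro: exec.Seq)

lemma wp_If [simp]:
  "wp B (IfGt p q c d) Q s \<longleftrightarrow> small_atom B p \<and> small_atom B q \<and>
     (if aval s p > aval s q then wp B c (\<lambda>t. Q (Suc t)) s else wp B d (\<lambda>t. Q (Suc t)) s)"
  by (auto simp: wp_def elim!: IfE; blast intro: exec.If_True exec.If_False)

text \<open>\<open>V\<close> bounds the remaining rounds and \<open>T\<close> the time of one body.
  \<open>Suc T\<close> includes the test of each round, and the final 1 is the failing test.\<close>

lemma wp_While:
  assumes "I s" and atoms: "small_atom B p" "small_atom B q"
    and body: "\<And>s. I s \<Longrightarrow> aval s p > aval s q \<Longrightarrow> wp B c (\<lambda>t s'. t \<le> T \<and> I s' \<and> V s' < V s) s"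
    and exit: "\<And>t s'. t \<le> V s * Suc T + 1 \<Longrightarrow> I s' \<Longrightarrow> \<not> aval s' p > aval s' q \<Longrightarrow> Q t s'"
  shows "wp B (WhileGt p q c) Q s"
proof -
  have "\<exists>t s'. exec B (WhileGt p q c) s t s' \<and> t \<le> V s * Suc T + 1 \<and> I s' \<and> \<not> aval s' p > aval s' q"
    using \<open>I s\<close>
  proof (induction "V s" arbitrary: s rule: less_induct)
    case less
    show ?case
    proof (cases "aval s p > aval s q")
      case True
      with body less.prems obtain t s' where 1: "exec B c s t s'" "t \<le> T" "I s'" "V s' < V s"
        unfolding wp_def by blast
      with less.hyps obtain u s'' where 2: "exec B (WhileGt p q c) s' u s''"
        "u \<le> V s' * Suc T + 1" "I s''" "\<not> aval s'' p > aval s'' q" by blast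
      have "Suc (V s') * Suc T \<le> V s * Suc T"
        using 1(4) by (intro mult_right_mono) auto
      then have "Suc (t + u) \<le> V s * Suc T + 1"
        using 1(2) 2(2) by simp
      with exec.While_True[OF atoms True 1(1) 2(1)] 2 show ?thesis by blast
    next
      case False
      with exec.While_False[OF atoms False] less.prems show ?thesis by force
    qed
  qed
  then show ?thesis using exit unfolding wp_def by blast
qed

abbreviation mov :: "var \<Rightarrow> atom \<Rightarrow> com" where
  "mov x p \<equiv> Op Plus x p (Ct 0)"

abbreviation inc :: "var \<Rightarrow> com" where
  "inc x \<equiv> Op Plus x (Vr x) (Ct 1)"

definition same_except :: "var set \<Rightarrow> state \<Rightarrow> state \<Rightarrow> bool" where
  "same_except W s s' \<longleftrightarrow> (\<forall>v. v \<notin> W \<longrightarrow> vars s' v = vars s v) \<and> sinp s' = sinp s \<and> sout s' = sout s"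

section \<open>Euclid's algorithm with logarithmically many rounds\<close>

definition gcd_loop :: com where
  "gcd_loop =
     WhileGt (Vr vY) (Ct 0)
       (Op Quot vT (Vr vG) (Vr vY) ;; Op Times vT (Vr vT) (Vr vY) ;; Op Minus vT (Vr vG) (Vr vT) ;;
        mov vG (Vr vY) ;; mov vY (Vr vT))"

text \<open>A remainder by a divisor not exceeding \<open>a\<close> is at most
  \<open>a div 2\<close>, so a division step of Euclid's algorithm removes at least one bit.\<close>

lemma floorlog_mod_less:
  assumes "0 < b" "b \<le> (a::nat)"
  shows "floorlog 2 (a mod b) < floorlog 2 a"
proof -
  have "a mod b \<le> a div 2"
  proof (cases "b \<le> a div 2")
    case True
    then show ?thesis using assms(1) by (meson mod_less_divisor order.strict_implies_order order_trans)
  next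
    case False
    have "a mod b = a - b"
      using False assms by (subst mod_if) (auto simp: le_mod_geq)
    then show ?thesis using False by linarith
  qed
  then have "floorlog 2 (a mod b) \<le> floorlog 2 (a div 2)"
    by (rule floorlog_mono)
  also have "\<dots> < floorlog 2 a"
    using assms compute_floorlog[of 2 a] by simp
  finally show ?thesis .
qed

lemma floorlog_le_if_less: "x < 2 ^ B \<Longrightarrow> floorlog 2 x \<le> B"
  by (simp add: floorlog_le_iff)

lemma wp_gcd_loop:
  assumes init: "vars s vG = int g" "vars s vY = int y" and bnd: "g < 2 ^ B" "y < 2 ^ B"
    and Q: "\<And>t s'. t \<le> 12 * B + 7 \<Longrightarrow> vars s' vG = int (gcd g y) \<Longrightarrow> same_except {vG, vY, vT} s s' \<Longrightarrow>
      arrs s' = arrs s \<Longrightarrow> Q t s'"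
  shows "wp B gcd_loop Q s"
  unfolding gcd_loop_def
\<comment> \<open>If \<open>vG < vY\<close>, a round merely swaps the two; the extra unit of the
  variant pays for this, and it cannot recur since remainders are smaller than divisors. At most
  \<open>2 * B + 1\<close> rounds of 6 units and the last test give
  \<open>12 * B + 7\<close>.\<close>
proof (rule wp_While[where T = 5 and
      I = "\<lambda>s'. \<exists>g' y'. vars s' vG = int g' \<and> vars s' vY = int y' \<and> g' < 2 ^ B \<and> y' < 2 ^ B \<and>
        gcd g' y' = gcd g y \<and> same_except {vG, vY, vT} s s' \<and> arrs s' = arrs s" and
      V = "\<lambda>s'. floorlog 2 (nat (vars s' vG)) + floorlog 2 (nat (vars s' vY)) +
        (if vars s' vG < vars s' vY then 1 else 0)"], goal_cases)
  case 1
  show ?case using init bnd by (auto simp: same_except_def)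
next
  case (4 s')
  then obtain g' y' where s': "vars s' vG = int g'" "vars s' vY = int y'" "g' < 2 ^ B" "y' < 2 ^ B"
    "gcd g' y' = gcd g y" "same_except {vG, vY, vT} s s'" "arrs s' = arrs s" and y': "y' > 0"
    by auto
  have quot: "int (g' div y') = int g' div int y'" by (simp add: zdiv_int)
  have md: "int g' - int g' div int y' * int y' = int (g' mod y')"
    by (simp add: minus_div_mult_eq_mod zmod_int)
  have le: "g' div y' \<le> g'" "g' div y' * y' \<le> g'" "g' mod y' < y'"
    using y' by (simp_all add: div_times_less_eq_dividend)
  have nn: "int g' div int y' \<ge> 0" "int g' div int y' * int y' \<ge> 0"
    using y' by (simp_all add: pos_imp_zdiv_nonneg_iff)
  have "int (g' div y') < 2 ^ B" "int (g' div y' * y') < 2 ^ B" and md_small: "int (g' mod y') < 2 ^ B"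
    using s'(3,4) le by (simp_all only: of_nat_less_numeral_power_cancel_iff)
  then have small: "int g' div int y' < 2 ^ B" "int g' div int y' * int y' < 2 ^ B"
    by (simp_all only: of_nat_mult quot)
  have dec: "\<not> g' < y' \<Longrightarrow> floorlog 2 (g' mod y') < floorlog 2 g'" "\<not> y' < g' mod y'"
    using floorlog_mod_less[of y' g'] y' le(3) by auto
  have "gcd y' (g' mod y') = gcd g y"
    using s'(5) y' by (metis gcd.commute gcd_red_nat)
  then show ?case
    using s' y' nn small md md_small dec by (simp add: same_except_def)
next
  case (5 t s')
  then obtain g' where s': "vars s' vG = int g'" "gcd g' 0 = gcd g y" "same_except {vG, vY, vT} s s'"
    "arrs s' = arrs s" by auto
  have "floorlog 2 g \<le> B" "floorlog 2 y \<le> B"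
    using bnd by (simp_all add: floorlog_le_if_less)
  then have "t \<le> 12 * B + 7"
    using 5(1) init by (auto split: if_splits)
  with s' show ?case by (intro Q) auto
qed simp_all

section \<open>Computing the gcds\<close>

definition gcd_entry :: com where
  "gcd_entry = mov vY (Vr vX) ;; gcd_loop ;; Put aG vI (Vr vG) ;; inc vI"

text \<open>The omitted branch is pushed before \<open>gcd_entry\<close> because the gcd loop
  destroys \<open>vG\<close>. The kept branch overwrites entry \<open>vI\<close> in place, where the
  number of omissions is already right.\<close>

definition omit_body :: "nat \<Rightarrow> com" where
  "omit_body k =
     Get vD aD vI ;; Get vG aG vI ;;
     IfGt (Ct (int k)) (Vr vD)
       (inc vD ;; Put aD vL (Vr vD) ;; Put aG vL (Vr vG) ;; inc vL) Skip ;;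
     gcd_entry"

definition holds_list :: "state \<Rightarrow> (nat \<times> nat) list \<Rightarrow> bool" where
  "holds_list s ps \<longleftrightarrow> vars s vL = int (length ps) \<and>
     (\<forall>j < length ps. arrs s aD j = int (fst (ps ! j)) \<and> arrs s aG j = int (snd (ps ! j)))"

text \<open>The contents of the arrays when the first \<open>i\<close> old entries have been
  treated; this interpolates between \<open>ps\<close> and \<open>omit_step k x ps\<close>.\<close>

definition omit_partial :: "nat \<Rightarrow> nat \<Rightarrow> (nat \<times> nat) list \<Rightarrow> nat \<Rightarrow> (nat \<times> nat) list" where
  "omit_partial k x ps i =
     map (\<lambda>(d, g). (d, gcd g x)) (take i ps) @ drop i ps @
     map (\<lambda>(d, g). (Suc d, g)) (filter (\<lambda>(d, g). d < k) (take i ps))"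

lemma omit_partial_0 [simp]: "omit_partial k x ps 0 = ps"
  by (simp add: omit_partial_def)

lemma omit_partial_length [simp]: "omit_partial k x ps (length ps) = omit_step k x ps"
  by (simp add: omit_partial_def omit_step_def)

lemma length_omit_partial_le: "i \<le> length ps \<Longrightarrow> length (omit_partial k x ps i) \<le> length (omit_step k x ps)"
proof -
  assume "i \<le> length ps"
  have "length (filter P (take i ps)) \<le> length (filter P ps)" for P
    by (metis append_take_drop_id filter_append le_add1 length_append)
  with \<open>i \<le> length ps\<close> show ?thesis
    by (simp add: omit_partial_def omit_step_def)
qed

lemma length_le_omit_partial: "i \<le> length ps \<Longrightarrow> length ps \<le> length (omit_partial k x ps i)"
  by (simp add: omit_partial_def)

lemma omit_partial_nth: "i < length ps \<Longrightarrow> omit_partial k x ps i ! i = ps ! i"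
  by (simp add: omit_partial_def nth_append)

lemma omit_partial_Suc:
  assumes "i < length ps" and "ps ! i = (d, g)"
  shows "omit_partial k x ps (Suc i) =
    (omit_partial k x ps i @ (if d < k then [(Suc d, g)] else []))[i := (d, gcd g x)]"
proof -
  have "drop i ps = (d, g) # drop (Suc i) ps"
    using assms by (metis Cons_nth_drop_Suc)
  then show ?thesis
    using assms by (simp add: omit_partial_def take_Suc_conv_app_nth list_update_append)
qed

lemma holds_list_push:
  assumes "holds_list s ps" "vars s' vL = vars s vL + 1"
    "\<And>j. arrs s' aD j = (if j = nat (vars s vL) then int d else arrs s aD j)"
    "\<And>j. arrs s' aG j = (if j = nat (vars s vL) then int g else arrs s aG j)"
  shows "holds_list s' (ps @ [(d, g)])"
  using assms by (auto simp: holds_list_def nth_append less_Suc_eq)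

lemma holds_list_update:
  assumes "holds_list s ps" "vars s' vL = vars s vL" "i < length ps" "fst (ps ! i) = d"
    "\<And>j. arrs s' aD j = arrs s aD j" "\<And>j. arrs s' aG j = (if j = i then int g else arrs s aG j)"
  shows "holds_list s' (ps[i := (d, g)])"
  using assms by (auto simp: holds_list_def nth_list_update)

lemma wp_omit_body:
  assumes hold: "holds_list s (omit_partial k x ps i)" and i: "i < length ps"
    and I: "vars s vI = int i" and X: "vars s vX = int x"
    and bnd: "\<forall>p\<in>set ps. snd p < 2 ^ B" "x < 2 ^ B" "Suc k < 2 ^ B"
      "length (omit_step k x ps) < 2 ^ B"
    and Q: "\<And>t s'. t \<le> 12 * B + 18 \<Longrightarrow> holds_list s' (omit_partial k x ps (Suc i)) \<Longrightarrow>
      vars s' vI = int (Suc i) \<Longrightarrow> same_except {vD, vG, vL, vY, vT, vI} s s' \<Longrightarrow> Q t s'"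
  shows "wp B (omit_body k) Q s"
proof -
  obtain d g where dg: "ps ! i = (d, g)" by fastforce
  let ?qs = "omit_partial k x ps i"
  have iL: "i < length ?qs" using i length_le_omit_partial[of i ps k x] by simp
  have L: "vars s vL = int (length ?qs)" using hold by (simp add: holds_list_def)
  have DG: "arrs s aD i = int d" "arrs s aG i = int g"
    using hold iL omit_partial_nth[OF i, of k x] dg by (auto simp: holds_list_def)
  have g: "g < 2 ^ B" using bnd(1) dg i nth_mem by fastforce
  have k': "int (Suc k) < 2 ^ B" using bnd(3) by (simp only: of_nat_less_numeral_power_cancel_iff)
  have L1: "int (length (omit_partial k x ps (Suc i))) < 2 ^ B"
    using order_le_less_trans[OF length_omit_partial_le[OF Suc_leI[OF i]] bnd(4)]
    by (simp only: of_nat_less_numeral_power_cancel_iff)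
  have L2: "int (Suc (length ?qs)) < 2 ^ B" if "d < k"
    using L1 that unfolding omit_partial_Suc[OF i dg] by simp
  have i1: "int (Suc i) < 2 ^ B"
    using i length_le_omit_partial[of "Suc i" ps k x] L1 by linarith
  have one: "(1::int) < 2 ^ B" using k' by linarith
  have k0: "k < 2 ^ B" using bnd(3) by linarith
  \<comment> \<open>Both branches of the conditional continue with \<open>gcd_entry\<close>; it is
    treated once, with \<open>u\<close> for the time already spent.\<close>
  have tail: "wp B gcd_entry (\<lambda>t. Q (u + t)) s1"
    if s1: "holds_list s1 (?qs @ (if d < k then [(Suc d, g)] else []))" "vars s1 vG = int g"
      "same_except {vD, vG, vL} s s1" and u: "u \<le> 8" for u s1
  proof -
    have v: "vars s1 vI = int i" "vars s1 vX = int x"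
      using s1(3) I X by (auto simp: same_except_def)
    show ?thesis
      unfolding gcd_entry_def
      apply (simp add: v bnd(2))
      apply (rule wp_gcd_loop[where g = g and y = x])
          apply (simp_all add: s1 v g bnd)
      subgoal premises p for t s'
      proof -
        have vI: "vars s' vI = int i" using p(3) v by (simp add: same_except_def)
        have le: "t + u + 3 \<le> 12 * B + 18" using p(1) u by simp
        show ?thesis
          using i1 one vI apply simp
          apply (rule Q)
             apply (use p(1) u in simp)
          unfolding omit_partial_Suc[OF i dg]
            apply (rule holds_list_update[OF s1(1)])
                 apply (use p in \<open>simp_all add: same_except_def v\<close>)
          using s1(3) iL omit_partial_nth[OF i, of k x] dg
          apply (auto simp: nth_append same_except_def)
          done
      qed
      done
  qed
  show ?thesis
    unfolding omit_body_def
    apply (simp add: I DG L)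
    apply (intro conjI impI)
            apply (use k0 in simp)
           apply (use one in simp)
          apply (use k' in simp)
         apply (use one in simp)
        apply (use L2 in simp)
    subgoal premises p
    proof -
      let ?s1 = "set_var vL (int (length ?qs) + 1)
          (set_arr aG (length ?qs) (int g) (set_arr aD (length ?qs) (int d + 1)
            (set_var vD (int d + 1) (set_var vG (int g) (set_var vD (int d) s)))))"
      have "holds_list ?s1 (?qs @ [(Suc d, g)])"
        using L by (intro holds_list_push[OF hold]) auto
      then show ?thesis
        using tail[of ?s1 "Suc (Suc (Suc (Suc (Suc (Suc (Suc 0))))))"] p k0
        by (simp add: same_except_def)
    qed
     apply (use k0 in simp)
    subgoal premises p
    proof -
      let ?s1 = "set_var vG (int g) (set_var vD (int d) s)"
      have "holds_list ?s1 ?qs"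
        using hold by (simp add: holds_list_def)
      then show ?thesis
        using tail[of ?s1 "Suc (Suc (Suc 0))"] p by (simp add: same_except_def)
    qed
    done
qed

text \<open>\<open>vE\<close> freezes the old length, so that entries pushed during the loop are not
  processed again with the same input.\<close>

definition omit_loop :: "nat \<Rightarrow> com" where
  "omit_loop k = mov vE (Vr vL) ;; mov vI (Ct 0) ;; WhileGt (Vr vE) (Vr vI) (omit_body k)"

lemma wp_omit_loop:
  assumes hold: "holds_list s ps" and X: "vars s vX = int x"
    and bnd: "\<forall>p\<in>set ps. snd p < 2 ^ B" "x < 2 ^ B" "Suc k < 2 ^ B"
      "length (omit_step k x ps) < 2 ^ B" 
    and Q: "\<And>t s'. t \<le> length ps * (12 * B + 19) + 3 \<Longrightarrow> holds_list s' (omit_step k x ps) \<Longrightarrow>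
      same_except {vD, vG, vL, vY, vT, vI, vE} s s' \<Longrightarrow> Q t s'"
  shows "wp B (omit_loop k) Q s"
proof -
  have L: "vars s vL = int (length ps)" "length ps < 2 ^ B"
    using hold bnd(4) length_le_omit_partial[of "length ps" ps k x] by (auto simp: holds_list_def)
  let ?I = "\<lambda>s'. \<exists>i \<le> length ps. vars s' vI = int i \<and> vars s' vE = int (length ps) \<and>
    holds_list s' (omit_partial k x ps i) \<and> same_except {vD, vG, vL, vY, vT, vI, vE} s s'"
  have "wp B (WhileGt (Vr vE) (Vr vI) (omit_body k)) (\<lambda>t. Q (2 + t)) s1"
    if s1: "?I s1" "vars s1 vI = 0" for s1
  proof (rule wp_While[where I = ?I and T = "12 * B + 18" and
        V = "\<lambda>s. nat (vars s vE - vars s vI)"], goal_cases)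
    case 1
    show ?case by (rule s1)
  next
    case (4 s')
    then obtain i where i: "i < length ps" "vars s' vI = int i" "vars s' vE = int (length ps)"
      "holds_list s' (omit_partial k x ps i)" "same_except {vD, vG, vL, vY, vT, vI, vE} s s'"
      by auto
    have X': "vars s' vX = int x" using i(5) X by (simp add: same_except_def)
    show ?case
    proof (rule wp_omit_body[OF i(4,1,2) X' bnd], goal_cases)
      case (1 t s'')
      then show ?case
        using i by (auto simp: same_except_def intro!: exI[of _ "Suc i"])
    qed
  next
    case (5 t s')
    then have "t \<le> length ps * (12 * B + 19) + 1"
      using s1 by (auto simp: algebra_simps)
    moreover obtain "holds_list s' (omit_step k x ps)"
      "same_except {vD, vG, vL, vY, vT, vI, vE} s s'"
      using 5(2,3) by (auto simp: le_less)
    ultimately show ?case by (intro Q) auto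
  qed simp_all
  then show ?thesis
    unfolding omit_loop_def using L bnd hold X by (simp add: same_except_def holds_list_def)
qed

text \<open>Arrays start with zeros, so \<open>vL = 1\<close> already represents
  \<open>[(0, 0)]\<close>. \<open>vZ\<close> counts down from \<open>k + 1\<close> and stays
  positive iff at most \<open>k\<close> entries are read. \<open>vS\<close> starts at 1 to exceed
  every gcd strictly.\<close>

definition read_loop :: "nat \<Rightarrow> com" where
  "read_loop k =
     mov vS (Ct 1) ;; mov vL (Ct 1) ;; mov vZ (Ct (int (Suc k))) ;; Read vX ;;
     WhileGt (Vr vX) (Ct 0)
       (Op Plus vS (Vr vS) (Vr vX) ;; Op Minus vZ (Vr vZ) (Ct 1) ;; omit_loop k ;; Read vX)"

text \<open>\<open>M\<close> bounds the number of entries. The three conditions on \<open>B\<close>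
  make room for the Moebius values (up to \<open>2 ^ M\<close>), for the counters around
  \<open>k\<close> and the length, and for the gcds and \<open>vS\<close>.\<close>

locale bounded_input =
  fixes k :: nat and a :: "nat list" and B M :: nat
  assumes pos: "\<forall>x\<in>set a. x > 0"
    and M: "M = Suc k * Suc (length a) ^ k"
    and B: "M < B" "Suc k + length a < 2 ^ B" "1 + sum_list a < 2 ^ B"
begin

lemma length_omit_list_prefix:
  assumes "a = xs @ zs"
  shows "length (omit_list k xs) \<le> M"
proof -
  have "Suc (length xs) ^ k \<le> Suc (length a) ^ k"
    using assms by (intro power_mono) auto
  then show ?thesis
    unfolding M using length_omit_list_le[of k xs] by (meson le_trans mult_le_mono2)
qed

lemma M_less: "M < 2 ^ B"
  using B(1) by (meson less_exp order_less_trans)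

lemma one_less: "(1::int) < 2 ^ B"
  using B(1) by (intro one_less_power) auto

lemma wp_read_loop:
  assumes s: "sinp s = map int a" "sout s = []" "\<forall>A j. arrs s A j = 0"
    and Q: "\<And>t s'. t \<le> length a * (M * (12 * B + 19) + 7) + 5 \<Longrightarrow> holds_list s' (omit_list k a) \<Longrightarrow>
      vars s' vS = 1 + int (sum_list a) \<Longrightarrow> vars s' vZ = int (Suc k) - int (length a) \<Longrightarrow>
      sout s' = [] \<Longrightarrow> Q t s'"
  shows "wp B (read_loop k) Q s"
proof -
  \<comment> \<open>\<open>xs\<close> has been processed. The head of \<open>zs\<close> is already
    in \<open>vX\<close>, so the tape is one entry ahead; the variant below counts this entry as
    well.\<close>
  let ?I = "\<lambda>s'. \<exists>xs zs. a = xs @ zs \<and> holds_list s' (omit_list k xs) \<and>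
    vars s' vS = 1 + int (sum_list xs) \<and> vars s' vZ = int (Suc k) - int (length xs) \<and> sout s' = [] \<and>
    (case zs of [] \<Rightarrow> vars s' vX = 0 \<and> sinp s' = []
     | z # zs' \<Rightarrow> vars s' vX = int z \<and> sinp s' = map int zs')"
  let ?T = "M * (12 * B + 19) + 6"
  have elem: "int x < 2 ^ B" "x < 2 ^ B" if "x \<in> set a" for x
  proof -
    have "x \<le> sum_list a" using that by (simp add: member_le_sum_list)
    with B(3) show "x < 2 ^ B" by linarith
    then show "int x < 2 ^ B" by simp
  qed
  have loop: "wp B (WhileGt (Vr vX) (Ct 0)
      (Op Plus vS (Vr vS) (Vr vX) ;; Op Minus vZ (Vr vZ) (Ct 1) ;; omit_loop k ;; Read vX)) (\<lambda>t. Q (Suc (Suc (Suc (Suc t))))) s1"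
    if s1: "?I s1" "length (sinp s1) + (if vars s1 vX > 0 then 1 else 0) = length a" for s1
  proof (rule wp_While[where I = ?I and T = ?T and
        V = "\<lambda>s. length (sinp s) + (if vars s vX > 0 then 1 else 0)"], goal_cases)
    case 1
    show ?case by (rule s1)
  next
    case (4 s')
    then obtain xs zs where I: "a = xs @ zs" "holds_list s' (omit_list k xs)"
      "vars s' vS = 1 + int (sum_list xs)" "vars s' vZ = int (Suc k) - int (length xs)" "sout s' = []"
      "case zs of [] \<Rightarrow> vars s' vX = 0 \<and> sinp s' = []
        | z # zs' \<Rightarrow> vars s' vX = int z \<and> sinp s' = map int zs'"
      by blast
    with 4(2) obtain z zs' where zs: "zs = z # zs'" "vars s' vX = int z" "sinp s' = map int zs'"
      by (cases zs) auto
    have a: "a = (xs @ [z]) @ zs'" using I(1) zs by simp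
    have z: "z > 0" "z < 2 ^ B" using pos elem[of z] by (auto simp: a)
    have sum: "1 + int (sum_list xs) + int z < 2 ^ B"
    proof -
      have "1 + sum_list xs + z < 2 ^ B" using B(3) by (simp add: a)
      then show ?thesis by (metis of_nat_1 of_nat_add of_nat_less_numeral_power_cancel_iff)
    qed
    have Z: "\<bar>int (Suc k) - int (length xs) - 1\<bar> < 2 ^ B"
    proof -
      have "int (Suc k + length a) < 2 ^ B" using B(2) by (simp only: of_nat_less_numeral_power_cancel_iff)
      then show ?thesis by (simp add: a)
    qed
    have ps: "\<forall>p\<in>set (omit_list k xs). snd p < 2 ^ B"
    proof
      fix p assume "p \<in> set (omit_list k xs)"
      then have "snd p \<in> gcd_set k xs" using snd_set_omit_list by blast
      then have "snd p \<le> sum_list xs" using pos by (intro gcd_set_le) (auto simp: a)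
      then show "snd p < 2 ^ B" using B(3) by (simp add: a)
    qed
    have len: "length (omit_list k xs) \<le> M" "length (omit_step k z (omit_list k xs)) \<le> M"
      using length_omit_list_prefix[OF I(1)] length_omit_list_prefix[OF a] by simp_all
    have k: "Suc k < 2 ^ B" using B(2) by linarith
    let ?s1 = "set_var vZ (int (Suc k) - int (length xs) - 1) (set_var vS (1 + int (sum_list xs) + int z) s')"
    have "wp B (omit_loop k ;; Read vX)
        (\<lambda>t s'. Suc (Suc t) \<le> ?T \<and> ?I s' \<and>
          length (sinp s') + (if vars s' vX > 0 then 1 else 0) < Suc (length zs')) ?s1"
      unfolding wp_Seq
    proof (rule wp_omit_loop[of _ "omit_list k xs" z], goal_cases)
      case (7 t s'')
      have "length (omit_list k xs) * (12 * B + 19) \<le> M * (12 * B + 19)"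
        using len by (intro mult_right_mono) auto
      with 7(1) have t: "t + 3 \<le> ?T" by linarith
      have s'': "sinp s'' = map int zs'" "vars s'' vS = 1 + int (sum_list (xs @ [z]))"
        "vars s'' vZ = int (Suc k) - int (length (xs @ [z]))" "sout s'' = []"
        using 7(3) zs I(5) by (auto simp: same_except_def)
      show ?case
      proof (cases zs')
        case Nil
        have "?I (set_var vX 0 s'')"
          by (rule exI[of _ "xs @ [z]"], rule exI[of _ "[]"])
            (use a 7(2) s'' Nil in \<open>auto simp: holds_list_def\<close>)
        with s'' t Nil show ?thesis by simp
      next
        case (Cons y ys)
        then have y: "y < 2 ^ B" using elem[of y] by (simp add: a)
        have "?I (set_var vX (int y) (s''\<lparr>sinp := map int ys\<rparr>))"
          by (rule exI[of _ "xs @ [z]"], rule exI[of _ "y # ys"])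
            (use a 7(2) s'' Cons in \<open>auto simp: holds_list_def\<close>)
        with s'' t y Cons show ?thesis by simp
      qed
    qed (use I zs z ps len M_less k in \<open>auto simp: holds_list_def\<close>)
    then show ?case
      using I zs z sum Z one_less by simp
  next
    case (5 t s')
    then obtain xs zs where I: "a = xs @ zs" "holds_list s' (omit_list k xs)"
      "vars s' vS = 1 + int (sum_list xs)" "vars s' vZ = int (Suc k) - int (length xs)" "sout s' = []"
      "case zs of [] \<Rightarrow> vars s' vX = 0 \<and> sinp s' = []
        | z # zs' \<Rightarrow> vars s' vX = int z \<and> sinp s' = map int zs'"
      by blast
    have "zs = []"
    proof (cases zs)
      case (Cons z zs')
      with I(1) pos have "z > 0" by simp
      with Cons I(6) 5(3) show ?thesis by simp
    qed simp
    moreover have "Suc (Suc (Suc (Suc t))) \<le> length a * (M * (12 * B + 19) + 7) + 5"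
      using 5(1) unfolding s1(2) by (simp add: algebra_simps)
    ultimately show ?case using I by (intro Q) auto
  qed simp_all
  have k: "\<bar>int (Suc k)\<bar> < 2 ^ B"
  proof -
    have "Suc k < 2 ^ B" using B(2) by linarith
    then have "int (Suc k) < 2 ^ B" by (simp only: of_nat_less_numeral_power_cancel_iff)
    then show ?thesis by simp
  qed
  let ?s0 = "set_var vZ (int (Suc k)) (set_var vL 1 (set_var vS 1 s))"
  have holds: "holds_list s' [(0, 0)]" if "arrs s' = arrs s" "vars s' vL = 1" for s'
    using that s(3) by (auto simp: holds_list_def)
  show ?thesis
  proof (cases a)
    case Nil
    let ?s1 = "set_var vX 0 ?s0"
    have "?I ?s1"
      by (rule exI[of _ "[]"], rule exI[of _ "[]"]) (use Nil s holds[of ?s1] in auto)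
    then show ?thesis
      unfolding read_loop_def using loop[of ?s1] s k one_less Nil by simp
  next
    case (Cons x xs)
    let ?s1 = "set_var vX (int x) (?s0\<lparr>sinp := map int xs\<rparr>)"
    have x: "x > 0" using pos Cons by simp
    have "?I ?s1"
      by (rule exI[of _ "[]"], rule exI[of _ a]) (use Cons s holds[of ?s1] in auto)
    then show ?thesis
      unfolding read_loop_def using loop[of ?s1] s k one_less Cons elem[of x] x by simp
  qed
qed

end

section \<open>Computing the table\<close>

text \<open>A full scan for the largest gcd strictly between 0 and \<open>vS\<close>; the result 0
  means that there is none. The strict bound \<open>vS\<close> also skips duplicates of values
  already written.\<close>

definition find_max :: com where
  "find_max =
     mov vC (Ct 0) ;; mov vI (Ct 0) ;;
     WhileGt (Vr vL) (Vr vI)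
       (Get vG aG vI ;;
        IfGt (Vr vG) (Vr vC) (IfGt (Vr vS) (Vr vG) (mov vC (Vr vG)) Skip) Skip ;;
        inc vI)"

lemma wp_find_max:
  assumes hold: "holds_list s ps" and S: "vars s vS = int p"
    and bnd: "length ps < 2 ^ B" "\<forall>p\<in>set ps. snd p < 2 ^ B" "0 < B"
    and Q: "\<And>t s' c. t \<le> length ps * 6 + 3 \<Longrightarrow> vars s' vC = int c \<Longrightarrow>
      c = 0 \<or> c \<in> snd ` set ps \<and> c < p \<Longrightarrow> \<forall>g \<in> snd ` set ps. g < p \<longrightarrow> g \<le> c \<Longrightarrow>
      same_except {vC, vI, vG} s s' \<Longrightarrow> arrs s' = arrs s \<Longrightarrow> Q t s'"
  shows "wp B find_max Q s"
proof -
  let ?I = "\<lambda>s'. \<exists>i c. i \<le> length ps \<and> vars s' vI = int i \<and> vars s' vC = int c \<and>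
    (c = 0 \<or> c \<in> snd ` set (take i ps) \<and> c < p) \<and>
    (\<forall>g \<in> snd ` set (take i ps). g < p \<longrightarrow> g \<le> c) \<and>
    same_except {vC, vI, vG} s s' \<and> arrs s' = arrs s"
  have L: "vars s vL = int (length ps)" using hold by (simp add: holds_list_def)
  have one: "(1::int) < 2 ^ B" using bnd(3) by (intro one_less_power) auto
  have loop: "wp B (WhileGt (Vr vL) (Vr vI)
       (Get vG aG vI ;;
        IfGt (Vr vG) (Vr vC) (IfGt (Vr vS) (Vr vG) (mov vC (Vr vG)) Skip) Skip ;;
        inc vI)) (\<lambda>t. Q (Suc (Suc t))) s1" if s1: "?I s1" "vars s1 vI = 0" for s1
  proof (rule wp_While[where I = ?I and T = 5 and V = "\<lambda>s. nat (vars s vL - vars s vI)"], goal_cases)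
    case 1
    show ?case by (rule s1)
  next
    case (4 s')
    then obtain i c where I: "i \<le> length ps" "vars s' vI = int i" "vars s' vC = int c"
      "c = 0 \<or> c \<in> snd ` set (take i ps) \<and> c < p" "\<forall>g \<in> snd ` set (take i ps). g < p \<longrightarrow> g \<le> c"
      "same_except {vC, vI, vG} s s'" "arrs s' = arrs s"
      by blast
    have v: "vars s' vL = int (length ps)" "vars s' vS = int p"
      using I(6) L S by (simp_all add: same_except_def)
    have i: "i < length ps" using 4(2) I(2) v by simp
    define g where "g = snd (ps ! i)"
    have g: "arrs s' aG i = int g" "g < 2 ^ B"
      using hold i bnd(2) I(7) by (auto simp: holds_list_def g_def)
    have take: "snd ` set (take (Suc i) ps) = insert g (snd ` set (take i ps))"
      using i by (simp add: take_Suc_conv_app_nth g_def)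
    have "int (Suc i) < 2 ^ B"
      using i bnd(1) by (simp only: of_nat_less_numeral_power_cancel_iff)
    then have i1: "int i + 1 < 2 ^ B" by simp
    show ?case
    proof (cases "c < g \<and> g < p")
      case True
      then have "?I (set_var vI (int (Suc i)) (set_var vC (int g) (set_var vG (int g) s')))"
        using I i by (intro exI[of _ "Suc i"] exI[of _ g]) (auto simp: take same_except_def)
      then show ?thesis using I(2,3) v g i i1 one True by (simp add: add.commute)
    next
      case False
      then have "?I (set_var vI (int (Suc i)) (set_var vG (int g) s'))"
        using I i by (intro exI[of _ "Suc i"] exI[of _ c]) (auto simp: take same_except_def)
      then show ?thesis using I(2,3) v g i i1 one False by (auto simp add: add.commute)
    qed
  next
    case (5 t s')
    then obtain i c where I: "i \<le> length ps" "vars s' vI = int i" "vars s' vC = int c"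
      "c = 0 \<or> c \<in> snd ` set (take i ps) \<and> c < p" "\<forall>g \<in> snd ` set (take i ps). g < p \<longrightarrow> g \<le> c"
      "same_except {vC, vI, vG} s s'" "arrs s' = arrs s"
      by blast
    have v: "vars s' vL = int (length ps)"
      using I(6) L by (simp add: same_except_def)
    then have "i = length ps" using 5(3) I(1,2) by simp
    moreover have "vars s1 vL = int (length ps)" using s1(1) L by (auto simp: same_except_def)
    then have "t \<le> length ps * 6 + 1" using 5(1) s1(2) by simp
    ultimately show ?case using I by (intro Q[of _ s' c]) auto
  qed simp_all
  have "?I (set_var vI 0 (set_var vC 0 s))"
    by (intro exI[of _ 0]) (simp add: same_except_def)
  then show ?thesis
    unfolding find_max_def using loop by simp
qed

text \<open>Evaluates the right-hand side of \<open>mu_rec\<close> over the table, with a remainder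
  as divisibility test. A table entry 0 leaves remainder 0 and so counts as a multiple.\<close>

definition mu_sum :: com where
  "mu_sum =
     mov vR (Ct 1) ;; mov vI (Ct 0) ;;
     WhileGt (Vr vK) (Vr vI)
       (Get vG aF vI ;; Op Quot vT (Vr vG) (Vr vC) ;; Op Times vT (Vr vT) (Vr vC) ;;
        Op Minus vT (Vr vG) (Vr vT) ;;
        IfGt (Vr vT) (Ct 0) Skip (Get vT aM vI ;; Op Minus vR (Vr vR) (Vr vT)) ;;
        inc vI)"

definition table_body :: com where
  "table_body =
     find_max ;;
     IfGt (Vr vC) (Ct 0)
       (mu_sum ;; Put aF vK (Vr vC) ;; Put aM vK (Vr vR) ;; Write (Vr vC) ;; Write (Vr vR) ;; inc vK)
       Skip ;;
     mov vS (Vr vC)"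

text \<open>\<open>find_max\<close> can never return 0, and 0 is a multiple of every gcd, so its row
  is written ahead of the loop. Its Moebius value is 1 as it has no proper multiple.\<close>

definition write_table :: com where
  "write_table =
     mov vK (Ct 0) ;;
     IfGt (Vr vZ) (Ct 0)
       (Put aF vK (Ct 0) ;; Put aM vK (Ct 1) ;; Write (Ct 0) ;; Write (Ct 1) ;; inc vK)
       Skip ;;
     WhileGt (Vr vS) (Ct 0) table_body"

context bounded_input
begin

section \<open>Partial Moebius sums and their growth\<close>

definition holds_table :: "state \<Rightarrow> nat list \<Rightarrow> bool" where
  "holds_table s fs \<longleftrightarrow> vars s vK = int (length fs) \<and>
     (\<forall>j < length fs. arrs s aF j = int (fs ! j) \<and> arrs s aM j = mu k a (fs ! j))"

definition mu_diff :: "nat \<Rightarrow> nat list \<Rightarrow> int" where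
  "mu_diff f fs = 1 - (\<Sum>g\<leftarrow>filter (\<lambda>g. f dvd g) fs. mu k a g)"

definition mu_bounded :: "nat list \<Rightarrow> bool" where
  "mu_bounded fs \<longleftrightarrow> (\<forall>i < length fs. \<bar>mu k a (fs ! i)\<bar> \<le> 2 ^ i)"

lemma mu_diff_snoc: "mu_diff f (fs @ [g]) = mu_diff f fs - (if f dvd g then mu k a g else 0)"
  by (simp add: mu_diff_def)

text \<open>At worst each entry doubles the bound, since \<open>2 ^ i + 2 ^ i = 2 ^ (i + 1)\<close>.
  Applied to prefixes, it also keeps every intermediate value of \<open>vR\<close> small.\<close>

lemma abs_mu_diff_le: "mu_bounded fs \<Longrightarrow> \<bar>mu_diff f fs\<bar> \<le> 2 ^ length fs"
proof (induction fs rule: rev_induct)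
  case (snoc g fs)
  have "mu_bounded fs"
    unfolding mu_bounded_def
  proof (intro allI impI)
    fix i assume "i < length fs"
    then show "\<bar>mu k a (fs ! i)\<bar> \<le> 2 ^ i"
      using snoc.prems unfolding mu_bounded_def by (auto dest: spec[of _ i] simp: nth_append)
  qed
  moreover have "\<bar>mu k a g\<bar> \<le> 2 ^ length fs"
    using snoc.prems unfolding mu_bounded_def by (auto dest: spec[of _ "length fs"] simp: nth_append)
  ultimately show ?case
    using snoc.IH by (auto simp: mu_diff_snoc)
qed (simp add: mu_diff_def)

lemma mu_bounded_take: "mu_bounded fs \<Longrightarrow> mu_bounded (take i fs)"
  by (simp add: mu_bounded_def)

lemma mu_eq_mu_diff:
  assumes "f \<in> gcd_set k a" "distinct fs" "{g \<in> gcd_set k a. f dvd g \<and> g \<noteq> f} = {g \<in> set fs. f dvd g}"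
  shows "mu k a f = mu_diff f fs"
  using assms by (simp add: mu_rec mu_diff_def sum_list_distinct_conv_sum_set)

lemma wp_mu_sum:
  assumes hold: "holds_table s fs" and C: "vars s vC = int f" "f > 0"
    and bnd: "mu_bounded fs" "length fs \<le> M" "\<forall>g\<in>set fs. g < 2 ^ B"
    and Q: "\<And>t s'. t \<le> length fs * 9 + 3 \<Longrightarrow> vars s' vR = mu_diff f fs \<Longrightarrow>
      same_except {vR, vI, vG, vT} s s' \<Longrightarrow> arrs s' = arrs s \<Longrightarrow> Q t s'"
  shows "wp B mu_sum Q s"
proof -
  let ?I = "\<lambda>s'. \<exists>i \<le> length fs. vars s' vI = int i \<and> vars s' vR = mu_diff f (take i fs) \<and>
    same_except {vR, vI, vG, vT} s s' \<and> arrs s' = arrs s"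
  have K: "vars s vK = int (length fs)" using hold by (simp add: holds_table_def)
  have small: "\<bar>mu_diff f (take i fs)\<bar> < 2 ^ B" if "i \<le> length fs" for i
  proof -
    have "\<bar>mu_diff f (take i fs)\<bar> \<le> 2 ^ i"
      using abs_mu_diff_le[OF mu_bounded_take[OF bnd(1)], of f i] that by simp
    also have "\<dots> < 2 ^ B"
      using that bnd(2) B(1) by (intro power_strict_increasing) auto
    finally show ?thesis .
  qed
  have loop: "wp B (WhileGt (Vr vK) (Vr vI)
       (Get vG aF vI ;; Op Quot vT (Vr vG) (Vr vC) ;; Op Times vT (Vr vT) (Vr vC) ;;
        Op Minus vT (Vr vG) (Vr vT) ;;
        IfGt (Vr vT) (Ct 0) Skip (Get vT aM vI ;; Op Minus vR (Vr vR) (Vr vT)) ;;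
        inc vI)) (\<lambda>t. Q (Suc (Suc t))) s1" if s1: "?I s1" "vars s1 vI = 0" for s1
  proof (rule wp_While[where I = ?I and T = 8 and V = "\<lambda>s. nat (vars s vK - vars s vI)"], goal_cases)
    case 1
    show ?case by (rule s1)
  next
    case (4 s')
    then obtain i where I: "vars s' vI = int i" "vars s' vR = mu_diff f (take i fs)"
      "same_except {vR, vI, vG, vT} s s'" "arrs s' = arrs s"
      by blast
    have v: "vars s' vK = int (length fs)" "vars s' vC = int f"
      using I(3) K C by (simp_all add: same_except_def)
    have i: "i < length fs" using 4(2) I(1) v by simp
    define g where "g = fs ! i"
    have g: "arrs s aF i = int g" "arrs s aM i = mu k a g" "g < 2 ^ B"
      using hold i bnd(3) I(4) by (auto simp: holds_table_def g_def)
    have take: "take (Suc i) fs = take i fs @ [g]"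
      using i by (simp add: take_Suc_conv_app_nth g_def)
    have "int (Suc i) < 2 ^ B"
      using i bnd(2) M_less by (simp only: of_nat_less_numeral_power_cancel_iff)
    then have i1: "int i + 1 < 2 ^ B" by simp
    have md: "int g - int g div int f * int f = int (g mod f)"
      by (simp add: minus_div_mult_eq_mod zmod_int)
    have nn: "int g div int f \<ge> 0" "int g div int f * int f \<ge> 0"
      using C(2) by (simp_all add: pos_imp_zdiv_nonneg_iff)
    have le: "g div f \<le> g" "g div f * f \<le> g" "g mod f \<le> g"
      by (simp_all add: div_times_less_eq_dividend)
    have "int (g div f) < 2 ^ B" "int (g div f * f) < 2 ^ B" and md_small: "int (g mod f) < 2 ^ B"
      using g(3) le by (simp_all only: of_nat_less_numeral_power_cancel_iff)
    then have sm: "int g div int f < 2 ^ B" "int g div int f * int f < 2 ^ B"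
      by (simp_all only: of_nat_mult zdiv_int)
    have R: "\<bar>mu_diff f (take (Suc i) fs)\<bar> < 2 ^ B"
      using i by (intro small) simp
    show ?case
    proof (cases "f dvd g")
      case True
      then have R': "mu_diff f (take (Suc i) fs) = mu_diff f (take i fs) - mu k a g"
        by (simp add: take mu_diff_snoc)
      have "g mod f = 0" using True by simp
      with md have md0: "int g - int g div int f * int f = 0" by simp
      show ?thesis
        using I v g i i1 one_less C nn sm md0 R
        by (simp add: same_except_def R' exI[of _ "Suc i"])
    next
      case False
      then have R': "mu_diff f (take (Suc i) fs) = mu_diff f (take i fs)"
        by (simp add: take mu_diff_snoc)
      have "g mod f > 0" using False by (simp add: dvd_eq_mod_eq_0)
      then show ?thesis
        using I v g i i1 one_less C nn sm md md_small R
        by (simp add: same_except_def R' exI[of _ "Suc i"])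
    qed
  next
    case (5 t s')
    then obtain i where I: "i \<le> length fs" "vars s' vI = int i" "vars s' vR = mu_diff f (take i fs)"
      "same_except {vR, vI, vG, vT} s s'" "arrs s' = arrs s"
      by blast
    have v: "vars s' vK = int (length fs)"
      using I(4) K by (simp add: same_except_def)
    then have "i = length fs" using 5(3) I(1,2) by simp
    moreover have "vars s1 vK = int (length fs)" using s1(1) K by (auto simp: same_except_def)
    then have "t \<le> length fs * 9 + 1" using 5(1) s1(2) by simp
    ultimately show ?case using I by (intro Q) auto
  qed simp_all
  have "?I (set_var vI 0 (set_var vR 1 s))"
    by (intro exI[of _ 0]) (simp add: same_except_def mu_diff_def)
  then show ?thesis
    unfolding mu_sum_def using loop one_less by simp
qed


text \<open>The separate clause for 0 keeps its row in the table from the start; for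
  \<open>p = 0\<close> the condition is vacuous and the table is complete.\<close>

definition table_upto :: "nat \<Rightarrow> nat list \<Rightarrow> state \<Rightarrow> bool" where
  "table_upto p fs s \<longleftrightarrow>
     vars s vS = int p \<and> holds_list s (omit_list k a) \<and> holds_table s fs \<and> distinct fs \<and>
     set fs = {g \<in> gcd_set k a. g = 0 \<or> p \<le> g} \<and> mu_bounded fs \<and>
     sout s = concat (map (\<lambda>f. [int f, mu k a f]) fs)"

lemma length_omit_list: "length (omit_list k a) \<le> M"
  using length_omit_list_prefix[of a "[]"] by simp

lemma card_gcd_set: "card (gcd_set k a) \<le> M"
proof -
  have "card (gcd_set k a) \<le> length (omit_list k a)"
    unfolding snd_set_omit_list[symmetric] by (metis card_image_le card_length finite_set le_trans)
  then show ?thesis using length_omit_list by linarith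
qed

lemma gcd_set_less: "g \<in> gcd_set k a \<Longrightarrow> g < 2 ^ B"
  using gcd_set_le[OF pos, of g k] B(3) by linarith

text \<open>The time adds up as \<open>6 * M + 3\<close> for the search, \<open>9 * M + 3\<close>
  for the sum, and 7 for the conditional, the new row and the final assignment.\<close>

lemma wp_table_body:
  assumes upto: "table_upto p fs s" and p: "p > 0"
    and Q: "\<And>t s' fs' c. t \<le> 15 * M + 13 \<Longrightarrow> table_upto c fs' s' \<Longrightarrow>
      c = 0 \<or> c \<in> gcd_set k a \<and> c < p \<Longrightarrow> Q t s'"
  shows "wp B table_body Q s"
proof -
  let ?ps = "omit_list k a"
  have S: "vars s vS = int p" and hold: "holds_list s ?ps" and table: "holds_table s fs"
    and dist: "distinct fs" and set: "set fs = {g \<in> gcd_set k a. g = 0 \<or> p \<le> g}"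
    and bnd: "mu_bounded fs" and out: "sout s = concat (map (\<lambda>f. [int f, mu k a f]) fs)"
    using upto by (auto simp: table_upto_def)
  have ps: "length ?ps \<le> M" "length ?ps < 2 ^ B" "\<forall>p\<in>set ?ps. snd p < 2 ^ B" "0 < B"
    using length_omit_list M_less gcd_set_less B(1) by (auto simp flip: snd_set_omit_list[of k a])
  have fs: "length fs \<le> M" "\<forall>g\<in>set fs. g < 2 ^ B"
  proof -
    have "length fs \<le> card (gcd_set k a)"
      unfolding distinct_card[OF dist, symmetric] set by (rule card_mono[OF finite_gcd_set]) auto
    then show "length fs \<le> M" using card_gcd_set by linarith
    show "\<forall>g\<in>set fs. g < 2 ^ B" using gcd_set_less set by auto
  qed
  show ?thesis
    unfolding table_body_def wp_Seq
  proof (rule wp_find_max[OF hold S ps(2-)], unfold snd_set_omit_list, goal_cases)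
    case (1 t s' c)
    have t: "t \<le> 6 * M + 3" using 1(1) ps(1) by linarith
    have table': "holds_table s' fs" using table 1(5,6) by (simp add: holds_table_def same_except_def)
    have hold': "holds_list s' ?ps" using hold 1(5,6) by (simp add: holds_list_def same_except_def)
    have out': "sout s' = sout s" using 1(5) by (simp add: same_except_def)
    have c_small: "int c < 2 ^ B"
      using 1(3) gcd_set_less[of c] by auto
    show ?case
    proof (cases "c = 0")
      case True
      have "set fs = {g \<in> gcd_set k a. g = 0 \<or> 0 \<le> g}"
        using 1(4) True set by (auto simp: not_le)
      then have "table_upto 0 fs (set_var vS 0 s')"
        using table' hold' dist bnd out out'
        by (simp add: table_upto_def holds_list_def holds_table_def)
      then show ?thesis
        using True 1(2) t by (auto intro!: Q)
    next
      case False
      with 1(3) have c: "c \<in> gcd_set k a" "0 < c" "c < p" by auto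
      have c_notin: "c \<notin> set fs" using c by (simp add: set)
      \<comment> \<open>A nonzero proper multiple of \<open>c\<close> exceeds \<open>c\<close>; by
        maximality of \<open>c\<close> below \<open>p\<close> it is at least \<open>p\<close>, hence
        already tabulated.\<close>
      have "{g \<in> gcd_set k a. c dvd g \<and> g \<noteq> c} = {g \<in> set fs. c dvd g}"
      proof -
        have "p \<le> g" if "g \<in> gcd_set k a" "c dvd g" "g \<noteq> c" "g \<noteq> 0" for g
        proof (rule ccontr)
          assume "\<not> p \<le> g"
          with 1(4) that(1) have "g \<le> c" by simp
          moreover have "c \<le> g" using that(2,4) by (simp add: dvd_imp_le)
          ultimately show False using that(3) by simp
        qed
        then show ?thesis using c_notin set by auto
      qed
      then have mu: "mu_diff c fs = mu k a c"
        using mu_eq_mu_diff[OF c(1) dist] by simp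
      have mu_le: "\<bar>mu k a c\<bar> \<le> 2 ^ length fs"
        using abs_mu_diff_le[OF bnd, of c] mu by simp
      have bnd': "mu_bounded (fs @ [c])"
        using bnd mu_le by (auto simp: mu_bounded_def nth_append less_Suc_eq)
      have set': "set (fs @ [c]) = {g \<in> gcd_set k a. g = 0 \<or> c \<le> g}"
        using 1(4) c set by (auto simp: not_le)
      \<comment> \<open>The counter \<open>vK\<close> can be increased because the extended table is
        still a list of distinct gcds.\<close>
      have "int (Suc (length fs)) < 2 ^ B"
      proof -
        have "length (fs @ [c]) \<le> card (gcd_set k a)"
          using distinct_card[of "fs @ [c]"] dist c_notin set'
          by (metis (no_types, lifting) card_mono distinct_append distinct_singleton empty_set finite_gcd_set
              disjoint_insert(1) inf_bot_right list.simps(15) mem_Collect_eq subsetI)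
        then have "Suc (length fs) < 2 ^ B" using card_gcd_set M_less by simp
        then show ?thesis by (simp only: of_nat_less_numeral_power_cancel_iff)
      qed
      then have K1: "int (length fs) + 1 < 2 ^ B" by simp
      have "wp B mu_sum (\<lambda>u. wp B (Put aF vK (Vr vC) ;; Put aM vK (Vr vR) ;; Write (Vr vC) ;;
          Write (Vr vR) ;; inc vK) (\<lambda>v. wp B (mov vS (Vr vC)) (\<lambda>w. Q (t + (Suc (u + v) + w))))) s'"
      proof (rule wp_mu_sum[OF table' 1(2) c(2) bnd fs], goal_cases)
        case (1 u s'')
        have K: "vars s'' vK = int (length fs)" "vars s'' vC = int c" "sout s'' = sout s"
          using 1(3) table' \<open>vars s' vC = int c\<close> out' by (simp_all add: same_except_def holds_table_def)
        let ?s = "set_var vS (int c) (set_var vK (int (length fs) + 1)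
            ((set_arr aM (length fs) (mu k a c) (set_arr aF (length fs) (int c) s''))
              \<lparr>sout := sout s @ [int c, mu k a c]\<rparr>))"
        have "holds_table ?s (fs @ [c])"
          using table' 1(3,4) by (auto simp: holds_table_def nth_append less_Suc_eq)
        moreover have "holds_list ?s ?ps"
          using hold' 1(3,4) by (auto simp: holds_list_def same_except_def)
        ultimately have "table_upto c (fs @ [c]) ?s"
          using dist c_notin set' bnd' out by (simp add: table_upto_def)
        moreover have "Suc (Suc (Suc (Suc (Suc (Suc (Suc (t + u))))))) \<le> 15 * M + 13"
          using t 1(1) fs(1) by simp
        ultimately have "Q (Suc (Suc (Suc (Suc (Suc (Suc (Suc (t + u)))))))) ?s"
          using c by (intro Q) auto
        then show ?case
          using K 1(2) mu c_small K1 one_less by (simp add: add.commute)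
      qed
      then show ?thesis
        using c \<open>vars s' vC = int c\<close> by simp
    qed
  qed
qed

lemma wp_write_table:
  assumes hold: "holds_list s (omit_list k a)" and S: "vars s vS = 1 + int (sum_list a)"
    and Z: "vars s vZ = int (Suc k) - int (length a)" and out: "sout s = []"
    and Q: "\<And>t s'. t \<le> Suc M * (15 * M + 14) + 8 \<Longrightarrow> is_moebius_table k a (sout s') \<Longrightarrow> Q t s'"
  shows "wp B write_table Q s"
proof -
  let ?I = "\<lambda>s. \<exists>p fs. table_upto p fs s"
  \<comment> \<open>The extra unit pays for the last round, which finds nothing and only sets
    \<open>vS\<close> to 0; the cardinality alone need not drop there.\<close>
  let ?V = "\<lambda>s. card {g \<in> gcd_set k a. int g < vars s vS} + (if vars s vS > 0 then 1 else 0)"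
  have loop: "wp B (WhileGt (Vr vS) (Ct 0) table_body) (\<lambda>t. Q (u + t)) s1"
    if s1: "?I s1" and u: "u \<le> 7" for s1 u
  proof (rule wp_While[where I = ?I and V = ?V and T = "15 * M + 13"], goal_cases)
    case 1
    show ?case by (rule s1)
  next
    case (4 s)
    then obtain p fs where upto: "table_upto p fs s" by blast
    then have S: "vars s vS = int p" by (simp add: table_upto_def)
    with 4(2) have "p > 0" by simp
    with upto show ?case
    proof (rule wp_table_body, goal_cases)
      case (1 t s' fs' c)
      then have S': "vars s' vS = int c" by (simp add: table_upto_def)
      have fin: "finite {g \<in> gcd_set k a. g < p}" using finite_gcd_set by simp
      have "?V s' < ?V s"
      proof (cases "c = 0")
        case True
        then show ?thesis using S S' \<open>p > 0\<close> by simp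
      next
        case False
        with 1(3) have "{g \<in> gcd_set k a. g < c} \<subset> {g \<in> gcd_set k a. g < p}" by auto
        then have "card {g \<in> gcd_set k a. g < c} < card {g \<in> gcd_set k a. g < p}"
          using fin by (rule psubset_card_mono[rotated])
        then show ?thesis using S S' \<open>p > 0\<close> by simp
      qed
      with 1 show ?case by blast
    qed
  next
    case (5 t s')
    then obtain p fs where upto: "table_upto p fs s'" by blast
    with 5(3) have "p = 0" by (simp add: table_upto_def)
    with upto have "is_moebius_table k a (sout s')"
      unfolding is_moebius_table_def by (intro exI[of _ fs]) (simp add: table_upto_def)
    moreover have "?V s1 \<le> Suc M"
    proof -
      have "card {g \<in> gcd_set k a. int g < vars s1 vS} \<le> card (gcd_set k a)"
        by (rule card_mono[OF finite_gcd_set]) auto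
      then show ?thesis using card_gcd_set by simp
    qed
    then have "?V s1 * Suc (15 * M + 13) \<le> Suc M * Suc (15 * M + 13)"
      by (rule mult_right_mono) simp
    then have "t \<le> Suc M * Suc (15 * M + 13) + 1"
      using 5(1) by linarith
    with u have "u + t \<le> Suc M * (15 * M + 14) + 8" by (simp add: algebra_simps)
    ultimately show ?case by (intro Q)
  qed simp_all
  \<comment> \<open>At the start no positive gcd reaches \<open>vS\<close>, so the invariant asks
    for the table \<open>[0]\<close> or \<open>[]\<close>, as decided by the sign of
    \<open>vZ\<close>.\<close>
  have gt: "{g \<in> gcd_set k a. g = 0 \<or> Suc (sum_list a) \<le> g} = (if length a \<le> k then {0} else {})"
    using zero_in_gcd_set_iff[OF pos, of k] gcd_set_le[OF pos, of _ k] by (fastforce simp: Suc_le_eq not_less)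
  have mu0: "mu k a 0 = 1" if "length a \<le> k"
  proof -
    have "{g \<in> gcd_set k a. 0 dvd g \<and> g \<noteq> 0} = {}" by auto
    then show ?thesis
      using that zero_in_gcd_set_iff[OF pos, of k] mu_rec[of 0 k a] by (simp only: sum.empty)
  qed
  show ?thesis
  proof (cases "length a \<le> k")
    case True
    let ?s = "set_var vK 1 ((set_arr aM 0 1 (set_arr aF 0 0 (set_var vK 0 s)))\<lparr>sout := [0, 1]\<rparr>)"
    have "table_upto (Suc (sum_list a)) [0] ?s"
      using hold S mu0 True
      by (simp add: table_upto_def holds_list_def holds_table_def mu_bounded_def gt)
    then have "?I ?s" by blast
    with True show ?thesis
      unfolding write_table_def using loop[of ?s "Suc (Suc (Suc (Suc (Suc (Suc (Suc 0))))))"] Z out one_less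
      by simp
  next
    case False
    let ?s = "set_var vK 0 s"
    have "table_upto (Suc (sum_list a)) [] ?s"
      using hold S False out
      by (simp add: table_upto_def holds_list_def holds_table_def mu_bounded_def gt)
    then have "?I ?s" by blast
    with False show ?thesis
      unfolding write_table_def using loop[of ?s "Suc (Suc 0)"] Z one_less
      by simp
  qed
qed

end

section \<open>From the bounds of the program to a polynomial in the input size\<close>

lemma length_le_input_size: "length xs \<le> input_size xs"
proof (induction xs)
  case (Cons x xs)
  have "1 \<le> bitlength x" by (simp add: bitlength_def)
  with Cons show ?case by (simp add: input_size_def)
qed (simp add: input_size_def)

text \<open>\<open>1 + x + s \<le> (1 + x) * (1 + s)\<close>, and bit lengths add up under
  multiplication.\<close>

lemma sum_list_less_input_size: "1 + sum_list a \<le> 2 ^ input_size (map int a)"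
proof (induction a)
  case (Cons x xs)
  have "int x < 2 ^ bitlength (int x)" using less_bitlength[of "int x"] by simp
  then have x: "x < 2 ^ bitlength (int x)" by simp
  have "(x + 1) * (1 + sum_list xs) \<le> 2 ^ bitlength (int x) * 2 ^ input_size (map int xs)"
    using x Cons by (intro mult_mono) auto
  then show ?case by (simp add: input_size_def power_add algebra_simps)
qed (simp add: input_size_def)

theorem theorem2p4:
  fixes k :: nat
  shows "poly_time_computable {a :: nat list. a \<noteq> [] \<and> (\<forall>\<alpha>\<in>set a. \<alpha> > 0)} (map int)
           (is_moebius_table k)"
proof -
  define prog where "prog = read_loop k ;; write_table"
  define size :: "nat poly" where "size = [:0, 1:]"
  define M where "M = of_nat (Suc k) * (1 + size) ^ k"
  \<comment> \<open>The summands serve the conditions of \<open>bounded_input\<close> in turn: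
    \<open>M\<close> for the Moebius values, \<open>size\<close> and \<open>k\<close> for the
    counters, and again \<open>size\<close> for the sum of the entries.\<close>
  define B where "B = M + size + of_nat k + 2"
  define T where "T = size * (M * (12 * B + 19) + 7) + 5 + ((1 + M) * (15 * M + 14) + 8)"
  \<comment> \<open>Cost per instruction, times six instructions per time unit, plus the final
    \<open>HALT\<close>.\<close>
  define p where "p = (4 * B + 20) * (6 * T) + 1"
  have "\<exists>ys t. ram_run (compile 0 prog @ [HALT]) (start_config (map int a)) ys t \<and>
      is_moebius_table k a ys \<and> t \<le> poly p (input_size (map int a))"
    if pos: "\<forall>\<alpha>\<in>set a. \<alpha> > 0" for a :: "nat list"
  proof -
    define n where "n = input_size (map int a)"
    define m where "m = Suc k * Suc (length a) ^ k"
    define b where "b = poly B n"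
    have len: "length a \<le> n" using length_le_input_size[of "map int a"] by (simp add: n_def)
    have pM: "poly M n = Suc k * Suc n ^ k" by (simp add: M_def size_def poly_power)
    have m: "m \<le> poly M n"
      unfolding m_def pM using len by (intro mult_left_mono power_mono) auto
    have b: "b = poly M n + n + k + 2" by (simp add: b_def B_def size_def)
    have lt: "x < 2 ^ x" for x :: nat by (rule less_exp)
    have "Suc k + length a < b" using b len by simp
    then have 1: "Suc k + length a < 2 ^ b" using lt[of b] by linarith
    have "(2::nat) ^ n < 2 ^ b" using b by (intro power_strict_increasing) auto
    then have 2: "1 + sum_list a < 2 ^ b" using sum_list_less_input_size[of a] unfolding n_def
      by (rule order_le_less_trans[rotated])
    interpret bounded_input k a b m
      using pos m_def m b 1 2 by unfold_locales auto
    let ?t = "length a * (m * (12 * b + 19) + 7) + 5 + (Suc m * (15 * m + 14) + 8)"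
    have "wp b prog (\<lambda>t s. t \<le> ?t \<and> is_moebius_table k a (sout s))
        \<lparr>vars = \<lambda>_. 0, arrs = \<lambda>_ _. 0, sinp = map int a, sout = []\<rparr>"
      unfolding prog_def wp_Seq
    proof (rule wp_read_loop, goal_cases)
      case (4 t s)
      show ?case by (rule wp_write_table[OF 4(2-5)]) (use 4(1) in auto)
    qed auto
    then obtain t s where s: "exec b prog
        \<lparr>vars = \<lambda>_. 0, arrs = \<lambda>_ _. 0, sinp = map int a, sout = []\<rparr> t s"
      "t \<le> ?t" "is_moebius_table k a (sout s)"
      unfolding wp_def by blast
    have "b > 0" using b by simp
    then obtain u where u: "u \<le> (4 * b + 20) * (6 * t) + 1"
      "ram_run (compile 0 prog @ [HALT]) (start_config (map int a)) (sout s) u"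
      using exec_imp_ram_run[OF s(1)] by blast
    \<comment> \<open>The program bounds use the length of the list; by monotonicity it is replaced
      by the input size, the variable of the polynomials.\<close>
    have "?t \<le> n * (poly M n * (12 * b + 19) + 7) + 5 + (Suc (poly M n) * (15 * poly M n + 14) + 8)"
      using len m by (intro add_mono mult_mono) auto
    also have "\<dots> = poly T n"
      by (simp add: T_def size_def b_def)
    finally have "t \<le> poly T n" using s(2) by linarith
    then have "(4 * b + 20) * (6 * t) + 1 \<le> (4 * b + 20) * (6 * poly T n) + 1"
      by (intro add_mono mult_left_mono) auto
    also have "\<dots> = poly p n" by (simp add: p_def b_def)
    finally show ?thesis using u s(3) unfolding n_def by (meson le_trans)
  qed
  then show ?thesis unfolding poly_time_computable_def by blast
qed

end
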